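(* Let $k_1\neq k_2$ be ramified quadratic extensions of $k_v$, and let $k_3$ be the unique quadratic extension of $k_v$ other than $k_1,k_2$ contained in the compositum $k_1\cdot k_2$. (1) Suppose $\ell_1=\ell_2=\ell$, $\delta_1=\delta_2=\delta$ and $\ell\leq\mathrm{lev}(k_1,k_2)\leq\delta$. Let $i=\mathrm{lev}(k_1,k_2)$. Then $\Delta_{k_1\cdot k_2/k_2}=\mathfrak{p}_2^{2(\delta-i)}$ and $\Delta_{k_3/k_v}=\mathfrak{p}_v^{2(\delta-i)}$. (2) Suppose $\ell_1>\ell_2$. Then $\Delta_{k_1\cdot k_2/k_1}=\mathfrak{p}_1^{\delta_2}$ and $\Delta_{k_1\cdot k_2/k_2}=\mathfrak{p}_2^{2\delta_1-\delta_2}$.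
   Context: $k_v$ is the completion of a number field at a dyadic place $v$ (so a finite extension of $\mathbb{Q}_2$), with ring of integers $\mathcal{O}_v$ and prime ideal $\mathfrak{p}_v$. All extensions are taken in a fixed algebraic closure; $\Delta_{L/K}$ denotes the relative discriminant ideal. For $j=1,2$, $\mathcal{O}_j$ is the ring of integers of $k_j$, $\mathfrak{p}_j=(\pi_j)$ its prime ideal, $\Delta_{k_j/k_v}=\mathfrak{p}_v^{\delta_j}$ and $\ell_j=\lfloor(\delta_j+1)/2\rfloor$. Let $z^2+a_1z+a_2\in\mathcal{O}_v[z]$ be an Eisenstein polynomial which is the minimal polynomial over $k_v$ of a uniformizer of $k_1$. For integers $i\ge 0$ put $$S_{i,i}(k_1,k_2)=\{\eta\in\mathcal{O}_2/\pi_2^{2i}\mathcal{O}_2 \mid \mathrm{Tr}_{k_2/k_v}(\eta)\equiv a_1\ (\mathfrak{p}_v^{i}),\ \mathrm{N}_{k_2/k_v}(\eta)\equiv a_2\ (\mathfrak{p}_v^{i})\}$$ (the conditions depend only on the class of $\eta$). The level $\mathrm{lev}(k_1,k_2)$ is the largest integer $i$ such that $S_{i,i}(k_1,k_2)\neq\emptyset$; it is finite and independent of the choice of Eisenstein polynomial. *)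

theory Defs
  imports "Jordan_Normal_Form.Determinant"
begin

section \<open>Subfields of an ambient field and their finite extensions\<close>

definition is_subfield :: "'a::field set \<Rightarrow> bool" where
  "is_subfield K \<longleftrightarrow> 0 \<in> K \<and> 1 \<in> K \<and>
     (\<forall>x\<in>K. \<forall>y\<in>K. x + y \<in> K \<and> x * y \<in> K) \<and>
     (\<forall>x\<in>K. - x \<in> K \<and> inverse x \<in> K)"

definition coeffs_in :: "'a::field set \<Rightarrow> 'a poly \<Rightarrow> bool" where
  "coeffs_in A p \<longleftrightarrow> (\<forall>i. coeff p i \<in> A)"

definition algebraic_over :: "'a::field set \<Rightarrow> 'a \<Rightarrow> bool" where
  "algebraic_over K x \<longleftrightarrow> (\<exists>p. p \<noteq> 0 \<and> coeffs_in K p \<and> poly p x = 0)"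

definition is_min_poly :: "'a::field set \<Rightarrow> 'a \<Rightarrow> 'a poly \<Rightarrow> bool" where
  "is_min_poly K x p \<longleftrightarrow> coeffs_in K p \<and> lead_coeff p = 1 \<and> poly p x = 0 \<and>
     (\<forall>q. q \<noteq> 0 \<and> coeffs_in K q \<and> poly q x = 0 \<longrightarrow> degree p \<le> degree q)"

text \<open>\<open>b 0, \<dots>, b (n - 1)\<close> is a basis of \<open>L\<close> as a vector space over \<open>K\<close>.\<close>

definition is_basis :: "'a::field set \<Rightarrow> 'a set \<Rightarrow> nat \<Rightarrow> (nat \<Rightarrow> 'a) \<Rightarrow> bool" where
  "is_basis K L n b \<longleftrightarrow> (\<forall>i<n. b i \<in> L) \<and>
     (\<forall>x\<in>L. \<exists>c. (\<forall>i<n. c i \<in> K) \<and> x = (\<Sum>i<n. c i * b i)) \<and>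
     (\<forall>c. (\<forall>i<n. c i \<in> K) \<and> (\<Sum>i<n. c i * b i) = 0 \<longrightarrow> (\<forall>i<n. c i = 0))"

definition extension_of_degree :: "'a::field set \<Rightarrow> 'a set \<Rightarrow> nat \<Rightarrow> bool" where
  "extension_of_degree K L n \<longleftrightarrow>
     is_subfield K \<and> is_subfield L \<and> K \<subseteq> L \<and> (\<exists>b. is_basis K L n b)"

definition compositum :: "'a::field set \<Rightarrow> 'a set \<Rightarrow> 'a set" where
  "compositum L M = \<Inter>{E. is_subfield E \<and> L \<union> M \<subseteq> E}"

text \<open>\<open>M\<close> is the matrix over \<open>K\<close> of multiplication by \<open>x\<close> with respect to the basis \<open>b\<close>.\<close>

definition is_mult_matrix ::
    "'a::field set \<Rightarrow> 'a set \<Rightarrow> nat \<Rightarrow> (nat \<Rightarrow> 'a) \<Rightarrow> 'a \<Rightarrow> 'a mat \<Rightarrow> bool" where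
  "is_mult_matrix K L n b x M \<longleftrightarrow> is_basis K L n b \<and> M \<in> carrier_mat n n \<and>
     (\<forall>i<n. \<forall>j<n. M $$ (i, j) \<in> K) \<and>
     (\<forall>j<n. x * b j = (\<Sum>i<n. M $$ (i, j) * b i))"

definition field_trace :: "'a::field set \<Rightarrow> 'a set \<Rightarrow> 'a \<Rightarrow> 'a" where
  "field_trace K L x =
     (THE t. \<exists>n b M. is_mult_matrix K L n b x M \<and> t = (\<Sum>i<n. M $$ (i, i)))"

definition field_norm :: "'a::field set \<Rightarrow> 'a set \<Rightarrow> 'a \<Rightarrow> 'a" where
  "field_norm K L x =
     (THE t. \<exists>n b M. is_mult_matrix K L n b x M \<and> t = det M)"

section \<open>Ideals of a subring \<open>A\<close> of the ambient field\<close>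

definition is_ideal :: "'a::field set \<Rightarrow> 'a set \<Rightarrow> bool" where
  "is_ideal A I \<longleftrightarrow> I \<subseteq> A \<and> 0 \<in> I \<and> (\<forall>x\<in>I. \<forall>y\<in>I. x + y \<in> I) \<and>
     (\<forall>a\<in>A. \<forall>x\<in>I. a * x \<in> I)"

definition ideal_gen :: "'a::field set \<Rightarrow> 'a set \<Rightarrow> 'a set" where
  "ideal_gen A S = \<Inter>{I. is_ideal A I \<and> S \<subseteq> I}"

fun ideal_pow :: "'a::field set \<Rightarrow> 'a set \<Rightarrow> nat \<Rightarrow> 'a set" where
  "ideal_pow A I 0 = A"
| "ideal_pow A I (Suc n) = ideal_gen A {x * y | x y. x \<in> I \<and> y \<in> ideal_pow A I n}"

section \<open>Completions of number fields at dyadic places\<close>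

text \<open>
  \<open>K\<close> is the completion of a number field \<open>F\<close> at a place above 2: \<open>v\<close> is the normalised
  discrete valuation (its value at 0 is irrelevant), \<open>K\<close> is complete for \<open>v\<close>,
  and \<open>F\<close> is dense in \<open>K\<close>.
\<close>

definition v_close :: "('a::field \<Rightarrow> int) \<Rightarrow> int \<Rightarrow> 'a \<Rightarrow> 'a \<Rightarrow> bool" where
  "v_close v N x y \<longleftrightarrow> x = y \<or> N \<le> v (x - y)"

locale dyadic_completion =
  fixes K :: "'a::field_char_0 set" and v :: "'a \<Rightarrow> int"
  assumes subfield: "is_subfield K"
    and v_mult: "\<lbrakk>x \<in> K; y \<in> K; x \<noteq> 0; y \<noteq> 0\<rbrakk> \<Longrightarrow> v (x * y) = v x + v y"
    and v_add: "\<lbrakk>x \<in> K; y \<in> K; x \<noteq> 0; y \<noteq> 0; x + y \<noteq> 0\<rbrakk> \<Longrightarrow> min (v x) (v y) \<le> v (x + y)"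
    and v_surj: "v ` (K - {0}) = UNIV"
    and complete: "\<lbrakk>\<And>n. s n \<in> K; \<And>N. \<exists>M::nat. \<forall>m\<ge>M. \<forall>n\<ge>M. v_close v N (s m) (s n)\<rbrakk>
          \<Longrightarrow> \<exists>l\<in>K. \<forall>N. \<exists>M. \<forall>n\<ge>M. v_close v N (s n) l"
    and number_field_dense: "\<exists>F n. extension_of_degree \<rat> F n \<and> F \<subseteq> K \<and>
          (\<forall>x\<in>K. \<forall>N. \<exists>y\<in>F. v_close v N y x)"
    and dyadic: "0 < v 2"

definition valuation_ring :: "'a::field set \<Rightarrow> ('a \<Rightarrow> int) \<Rightarrow> 'a set" where
  "valuation_ring K v = {x \<in> K. x = 0 \<or> 0 \<le> v x}"

section \<open>Arithmetic of finite extensions\<close>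

text \<open>
  In the following \<open>R\<close> is the valuation ring of the base field \<open>K\<close>. The ring of
  integers of a finite extension \<open>L\<close> of \<open>K\<close> is the integral closure of \<open>R\<close> in \<open>L\<close>;
  it is a discrete valuation ring, whose prime ideal is the set of its nonunits.
  For \<open>L = K\<close> one gets \<open>R\<close> back, see \<open>int_ring_base\<close>.
\<close>

definition int_ring :: "'a::field set \<Rightarrow> 'a set \<Rightarrow> 'a set" where
  "int_ring R L = {x \<in> L. \<exists>p. lead_coeff p = 1 \<and> coeffs_in R p \<and> poly p x = 0}"

definition prime_ideal :: "'a::field set \<Rightarrow> 'a set \<Rightarrow> 'a set" where
  "prime_ideal R L = {x \<in> int_ring R L. \<not> (\<exists>y\<in>int_ring R L. x * y = 1)}"

abbreviation prime_pow :: "'a::field set \<Rightarrow> 'a set \<Rightarrow> nat \<Rightarrow> 'a set" where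
  "prime_pow R L n \<equiv> ideal_pow (int_ring R L) (prime_ideal R L) n"

definition is_uniformizer :: "'a::field set \<Rightarrow> 'a set \<Rightarrow> 'a \<Rightarrow> bool" where
  "is_uniformizer R L t \<longleftrightarrow>
     t \<in> int_ring R L \<and> prime_ideal R L = ideal_gen (int_ring R L) {t}"

definition is_ramified :: "'a::field set \<Rightarrow> 'a set \<Rightarrow> 'a set \<Rightarrow> bool" where
  "is_ramified R K L \<longleftrightarrow>
     (\<exists>e\<ge>2. ideal_gen (int_ring R L) (prime_ideal R K) = prime_pow R L e)"

text \<open>The relative discriminant ideal is generated by the discriminants of all
  integral \<open>K\<close>-bases of \<open>L\<close>.\<close>

definition disc_ideal :: "'a::field set \<Rightarrow> 'a set \<Rightarrow> 'a set \<Rightarrow> 'a set" where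
  "disc_ideal R K L = ideal_gen (int_ring R K)
     {det (mat n n (\<lambda>(i, j). field_trace K L (b i * b j))) | n b.
        is_basis K L n b \<and> (\<forall>i<n. b i \<in> int_ring R L)}"

definition is_eisenstein :: "'a::field set \<Rightarrow> 'a set \<Rightarrow> 'a poly \<Rightarrow> bool" where
  "is_eisenstein R K p \<longleftrightarrow> 0 < degree p \<and> lead_coeff p = 1 \<and>
     (\<forall>i<degree p. coeff p i \<in> prime_ideal R K) \<and> coeff p 0 \<notin> prime_pow R K 2"

text \<open>
  The set \<open>S\<^sub>i\<^sub>,\<^sub>i(k\<^sub>1, k\<^sub>2)\<close> and the level. The field \<open>k\<^sub>1\<close> enters only through the
  Eisenstein polynomial \<open>z\<^sup>2 + a\<^sub>1 z + a\<^sub>2\<close> of one of its uniformizers. Residue classes are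
  cosets of \<open>\<pp>\<^sub>2\<^sup>2\<^sup>i\<close>. The congruence \<open>Tr \<eta> \<equiv> a\<^sub>1\<close> (instead of \<open>- a\<^sub>1\<close>) is intended;
  replacing \<open>\<eta>\<close> by \<open>- \<eta>\<close> shows that the sign does not affect the level.
\<close>

definition level_set ::
    "'a::field set \<Rightarrow> 'a set \<Rightarrow> 'a set \<Rightarrow> 'a \<Rightarrow> 'a \<Rightarrow> nat \<Rightarrow> 'a set set" where
  "level_set R K k2 a1 a2 i = {(\<lambda>x. \<eta> + x) ` prime_pow R k2 (2 * i) | \<eta>.
     \<eta> \<in> int_ring R k2 \<and>
     field_trace K k2 \<eta> - a1 \<in> prime_pow R K i \<and>
     field_norm K k2 \<eta> - a2 \<in> prime_pow R K i}"

definition level :: "'a::field set \<Rightarrow> 'a set \<Rightarrow> 'a set \<Rightarrow> 'a \<Rightarrow> 'a \<Rightarrow> nat" where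
  "level R K k2 a1 a2 = (GREATEST i. level_set R K k2 a1 a2 i \<noteq> {})"

definition third_quadratic :: "'a::field set \<Rightarrow> 'a set \<Rightarrow> 'a set \<Rightarrow> 'a set" where
  "third_quadratic K k1 k2 = (THE k3. extension_of_degree K k3 2 \<and>
     k3 \<noteq> k1 \<and> k3 \<noteq> k2 \<and> k3 \<subseteq> compositum k1 k2)"

context dyadic_completion
begin

lemma v_inverse:
  assumes "x \<in> K" "x \<noteq> 0"
  shows "v (inverse x) = - v x"
proof -
  have i: "inverse x \<in> K" "1 \<in> K" using subfield assms by (auto simp: is_subfield_def)
  have "v (1 * 1) = v 1 + v 1" using i by (intro v_mult) auto
  moreover have "v (x * inverse x) = v x + v (inverse x)" using assms i by (intro v_mult) auto
  ultimately show ?thesis using assms by simp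
qed

lemma valuation_ring_add:
  "\<lbrakk>x \<in> valuation_ring K v; y \<in> valuation_ring K v\<rbrakk> \<Longrightarrow> x + y \<in> valuation_ring K v"
  using v_add[of x y] subfield
  by (cases "x = 0"; cases "y = 0"; cases "x + y = 0")
     (auto simp: valuation_ring_def is_subfield_def min_def split: if_splits)

lemma valuation_ring_mult:
  "\<lbrakk>x \<in> valuation_ring K v; y \<in> valuation_ring K v\<rbrakk> \<Longrightarrow> x * y \<in> valuation_ring K v"
  using v_mult[of x y] subfield
  by (cases "x = 0"; cases "y = 0") (auto simp: valuation_ring_def is_subfield_def)

lemma valuation_ring_0: "0 \<in> valuation_ring K v"
  using subfield by (auto simp: valuation_ring_def is_subfield_def)

lemma valuation_ring_1: "1 \<in> valuation_ring K v"
  using subfield v_mult[of 1 1] by (auto simp: valuation_ring_def is_subfield_def)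

lemma valuation_ring_uminus:
  assumes "x \<in> valuation_ring K v" shows "- x \<in> valuation_ring K v"
proof -
  have m: "-1 \<in> K" "1 \<in> K" using subfield by (auto simp: is_subfield_def)
  have "v (-1 * -1) = v (-1) + v (-1)" using m by (intro v_mult) auto
  moreover have "v (1 * 1) = v 1 + v 1" using m by (intro v_mult) auto
  ultimately have "-1 \<in> valuation_ring K v" using m by (simp add: valuation_ring_def)
  from valuation_ring_mult[OF this assms] show ?thesis by simp
qed

lemma int_ring_base: "int_ring (valuation_ring K v) K = valuation_ring K v" (is "_ = ?R")
proof
  show "?R \<subseteq> int_ring ?R K"
  proof
    fix x assume x: "x \<in> ?R"
    have "coeffs_in ?R [:- x, 1:]"
      unfolding coeffs_in_def using valuation_ring_uminus[OF x] valuation_ring_0 valuation_ring_1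
      by (auto simp: coeff_pCons split: nat.splits)
    moreover have "lead_coeff [:- x, 1:] = 1" "poly [:- x, 1:] x = 0" by simp_all
    ultimately show "x \<in> int_ring ?R K"
      using x unfolding int_ring_def valuation_ring_def by blast
  qed
next
  show "int_ring ?R K \<subseteq> ?R"
  proof
    fix x assume "x \<in> int_ring ?R K"
    then obtain p where x: "x \<in> K" and p: "lead_coeff p = 1" "coeffs_in ?R p" "poly p x = 0"
      unfolding int_ring_def by blast
    show "x \<in> ?R"
    proof (rule ccontr)
      assume "x \<notin> ?R"
      then have nz: "x \<noteq> 0" and neg: "v x < 0" using x by (auto simp: valuation_ring_def)
      define y where "y = inverse x"
      have y: "y \<in> ?R" using v_inverse[OF x nz] neg subfield x
        by (auto simp: y_def valuation_ring_def is_subfield_def)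
      have "degree p \<noteq> 0"
      proof
        assume "degree p = 0"
        then obtain c where "p = [:c:]" by (rule degree_eq_zeroE)
        with p(1,3) show False by simp
      qed
      then obtain d where d: "degree p = Suc d" by (cases "degree p") auto
      have ypow: "y ^ k \<in> ?R" for k
        by (induction k) (auto intro: valuation_ring_1 valuation_ring_mult y)
      have "(\<Sum>i\<in>{..d}. coeff p i * y ^ (d - i)) \<in> ?R"
      proof -
        have "finite S \<Longrightarrow> (\<Sum>i\<in>S. coeff p i * y ^ (d - i)) \<in> ?R" for S
          by (induction S rule: finite_induct)
             (use p(2) ypow in \<open>auto intro!: valuation_ring_0 valuation_ring_add valuation_ring_mult simp: coeffs_in_def\<close>)
        then show ?thesis by simp
      qed
      moreover have "x = - (\<Sum>i\<in>{..d}. coeff p i * y ^ (d - i))"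
      proof -
        have "0 = y ^ d * ((\<Sum>i\<le>d. coeff p i * x ^ i) + x ^ Suc d)"
          using p(1,3) d by (simp add: poly_altdef)
        also have "\<dots> = (\<Sum>i\<le>d. coeff p i * (y ^ d * x ^ i)) + y ^ d * x ^ Suc d"
          by (simp add: algebra_simps sum_distrib_left)
        also have "(\<Sum>i\<le>d. coeff p i * (y ^ d * x ^ i)) = (\<Sum>i\<le>d. coeff p i * y ^ (d - i))"
        proof (intro sum.cong refl)
          fix i assume "i \<in> {..d}"
          then have "y ^ d = y ^ (d - i) * y ^ i" by (simp flip: power_add)
          then show "coeff p i * (y ^ d * x ^ i) = coeff p i * y ^ (d - i)"
            using nz by (simp add: y_def field_simps)
        qed
        also have "y ^ d * x ^ Suc d = x" using nz by (simp add: y_def field_simps)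
        finally show ?thesis by (simp add: eq_neg_iff_add_eq_0 add.commute)
      qed
      ultimately have "x \<in> ?R" using valuation_ring_uminus by metis
      with \<open>x \<notin> ?R\<close> show False ..
    qed
  qed
qed

end

end

theory Submission
  imports Defs
begin

text \<open>
  Let \<open>M = k\<^sub>1 k\<^sub>2\<close> and let \<open>t\<close> be a uniformizer of \<open>k\<^sub>1\<close>. Among the translates \<open>t - \<eta>\<close> with
  \<open>\<eta> \<in> k\<^sub>2\<close> choose one whose norm to \<open>k\<^sub>2\<close> has maximal valuation \<open>s\<close>. If \<open>s\<close> is odd, a scalar multiple
  of \<open>t - \<eta>\<close> is a uniformizer of \<open>M\<close>; if \<open>s\<close> is even, then \<open>M/k\<^sub>2\<close> is unramified because the residue
  field is perfect. Both cases give \<open>2 \<delta>\<^sub>1 - 2 \<lfloor>s/2\<rfloor>\<close> as the exponent of the discriminant of \<open>M/k\<^sub>2\<close>.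
  With \<open>T\<close>, \<open>n\<close> the trace and norm of \<open>\<eta>\<close>, the norm of \<open>t - \<eta>\<close> is
  \<open>(T + a\<^sub>1) \<eta> + (a\<^sub>2 - n)\<close>, whose two terms have valuations of different parity when \<open>\<eta>\<close> is a
  uniformizer. This identifies
  \<open>\<lfloor>s/2\<rfloor>\<close> with the level, and with \<open>\<ell>\<^sub>2\<close> if \<open>\<ell>\<^sub>1 > \<ell>\<^sub>2\<close>. The norm of \<open>t - \<eta>\<close> to \<open>k\<^sub>3\<close> generates \<open>k\<^sub>3\<close>,
  its norm to \<open>K\<close> has valuation \<open>s\<close> and its discriminant has valuation \<open>\<delta>\<^sub>1 + \<delta>\<^sub>2\<close>, which yields the
  discriminant of \<open>k\<^sub>3\<close>.
\<close>

section \<open>Subfields\<close>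

text \<open>Translating \<open>t\<close> is harmless because the discriminant
  \<open>(Tr x)^2 - 4 N x\<close> does not change under translation and is multiplied by
  \<open>c^2\<close> under scaling by \<open>c\<close>. So \<open>t\<close> still yields the
  discriminant of \<open>M\<close> over \<open>k2\<close>, although \<open>1, t\<close> is in
  general no integral basis there: counted in \<open>k2\<close> the valuation of its discriminant
  doubles to \<open>2 \<delta>1\<close>, and a scaling factor of valuation
  \<open>- (s div 2)\<close> accounts for the rest. The same invariance bounds \<open>s\<close>, so
  a maximum exists. For even \<open>s\<close> maximality forces \<open>s = 2 \<delta>1\<close>, and
  the formula then gives exponent 0. On every extension the valuation used is \<open>w\<close> of
  the norm, not halved: multiplicativity is immediate, a ramified extension gets a normalised
  valuation, and only the ultrametric inequality costs Hensel's lemma. The axioms give a dense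
  number field but say nothing about the residue field. That it is perfect comes from a rational
  linear relation between \<open>x, x^2, x^4, ...\<close>.\<close>

lemma is_subfieldD:
  assumes "is_subfield k"
  shows subfield_0: "0 \<in> k" and subfield_1: "1 \<in> k"
    and subfield_add: "\<And>x y. x \<in> k \<Longrightarrow> y \<in> k \<Longrightarrow> x + y \<in> k"
    and subfield_mult: "\<And>x y. x \<in> k \<Longrightarrow> y \<in> k \<Longrightarrow> x * y \<in> k"
    and subfield_uminus: "\<And>x. x \<in> k \<Longrightarrow> - x \<in> k"
    and subfield_inverse: "\<And>x. x \<in> k \<Longrightarrow> inverse x \<in> k"
  using assms by (auto simp: is_subfield_def)

lemma subfield_diff: "is_subfield k \<Longrightarrow> x \<in> k \<Longrightarrow> y \<in> k \<Longrightarrow> x - y \<in> k"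
  using subfield_add[of k x "- y"] subfield_uminus[of k y] by simp

lemma subfield_divide: "is_subfield k \<Longrightarrow> x \<in> k \<Longrightarrow> y \<in> k \<Longrightarrow> x / y \<in> k"
  by (simp add: divide_inverse subfield_mult subfield_inverse)

lemma subfield_power: "is_subfield k \<Longrightarrow> x \<in> k \<Longrightarrow> x ^ n \<in> k"
  by (induction n) (auto intro: subfield_1 subfield_mult)

lemma subfield_power_int: "is_subfield k \<Longrightarrow> x \<in> k \<Longrightarrow> x powi n \<in> k"
  by (auto simp: power_int_def intro: subfield_power subfield_inverse)

lemma subfield_of_nat: "is_subfield k \<Longrightarrow> of_nat n \<in> k"
  by (induction n) (auto intro: subfield_0 subfield_1 subfield_add)

lemma subfield_of_int: "is_subfield k \<Longrightarrow> of_int n \<in> k"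
  by (cases n rule: int_cases2) (auto intro: subfield_of_nat subfield_uminus)

lemma subfield_numeral: "is_subfield k \<Longrightarrow> numeral n \<in> k"
  using subfield_of_nat[of k "numeral n"] by simp

lemma subfield_of_rat: "is_subfield k \<Longrightarrow> of_rat q \<in> k"
  by (cases q) (auto simp: of_rat_rat intro!: subfield_divide subfield_of_int)

lemma subfield_sum: "is_subfield k \<Longrightarrow> (\<And>i. i \<in> S \<Longrightarrow> f i \<in> k) \<Longrightarrow> sum f S \<in> k"
  by (induction S rule: infinite_finite_induct) (auto intro: subfield_0 subfield_add)

lemmas subfield_intros = subfield_0 subfield_1 subfield_add subfield_mult subfield_uminus
  subfield_inverse subfield_diff subfield_divide subfield_power subfield_power_int
  subfield_of_nat subfield_of_int subfield_numeral subfield_of_rat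

section \<open>Valuations\<close>

text \<open>These are fractional ideals, so \<open>n\<close> may be negative; \<open>w 0\<close> is
  arbitrary, hence the separate clause for 0.\<close>

definition val_ge :: "'a::field set \<Rightarrow> ('a \<Rightarrow> int) \<Rightarrow> int \<Rightarrow> 'a set" where
  "val_ge k w n = {x \<in> k. x = 0 \<or> n \<le> w x}"

lemma valuation_ring_eq_val_ge: "valuation_ring k w = val_ge k w 0"
  by (auto simp: valuation_ring_def val_ge_def)

text \<open>Surjectivity of \<open>w\<close> is left to \<open>dyadic_field\<close>: the norm
  valuation of an unramified quadratic extension takes only even values and has to fit here
  too.\<close>

locale valued_subfield =
  fixes k :: "'a::field_char_0 set" and w :: "'a \<Rightarrow> int"
  assumes sub: "is_subfield k"
    and w_mult: "\<lbrakk>x \<in> k; y \<in> k; x \<noteq> 0; y \<noteq> 0\<rbrakk> \<Longrightarrow> w (x * y) = w x + w y"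
    and w_add: "\<lbrakk>x \<in> k; y \<in> k; x \<noteq> 0; y \<noteq> 0; x + y \<noteq> 0\<rbrakk> \<Longrightarrow> min (w x) (w y) \<le> w (x + y)"
begin

lemmas k_intros [simp] = subfield_intros[OF sub]

abbreviation P :: "int \<Rightarrow> 'a set" where "P \<equiv> val_ge k w"

lemma w_1 [simp]: "w 1 = 0"
  using w_mult[of 1 1] by auto

lemma w_inverse: "x \<in> k \<Longrightarrow> x \<noteq> 0 \<Longrightarrow> w (inverse x) = - w x"
  using w_mult[of x "inverse x"] by auto

lemma w_divide: "x \<in> k \<Longrightarrow> y \<in> k \<Longrightarrow> x \<noteq> 0 \<Longrightarrow> y \<noteq> 0 \<Longrightarrow> w (x / y) = w x - w y"
  using w_mult[of x "inverse y"] by (auto simp: w_inverse divide_inverse)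

lemma w_power: "x \<in> k \<Longrightarrow> x \<noteq> 0 \<Longrightarrow> w (x ^ n) = int n * w x"
  by (induction n) (auto simp: w_mult algebra_simps)

lemma w_power_int: "x \<in> k \<Longrightarrow> x \<noteq> 0 \<Longrightarrow> w (x powi n) = n * w x"
  by (auto simp: power_int_def w_power w_inverse)

lemma w_uminus [simp]: "x \<in> k \<Longrightarrow> w (- x) = w x"
proof (cases "x = 0")
  case False
  assume x: "x \<in> k"
  have "w (-1 * -1) = w (-1) + w (-1)" by (intro w_mult) auto
  then have "w (-1) = 0" by simp
  then show ?thesis using w_mult[of "-1" x] x False by auto
qed simp

lemma P_k: "x \<in> P n \<Longrightarrow> x \<in> k" by (simp add: val_ge_def)

lemma P_0 [simp, intro]: "0 \<in> P n" by (auto simp: val_ge_def)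

lemma P_1: "1 \<in> P 0" by (auto simp: val_ge_def)

lemma P_iff: "x \<in> k \<Longrightarrow> x \<noteq> 0 \<Longrightarrow> x \<in> P n \<longleftrightarrow> n \<le> w x"
  by (simp add: val_ge_def)

lemma P_mono: "x \<in> P n \<Longrightarrow> m \<le> n \<Longrightarrow> x \<in> P m" by (auto simp: val_ge_def)

lemma P_uminus: "x \<in> P n \<Longrightarrow> - x \<in> P n" by (auto simp: val_ge_def)

lemma P_add: "x \<in> P n \<Longrightarrow> y \<in> P n \<Longrightarrow> x + y \<in> P n"
  using w_add[of x y]
  by (cases "x = 0"; cases "y = 0"; cases "x + y = 0")
    (auto simp: val_ge_def min_def split: if_splits)

lemma P_diff: "x \<in> P n \<Longrightarrow> y \<in> P n \<Longrightarrow> x - y \<in> P n"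
  using P_add[of x n "- y"] P_uminus[of y n] by simp

lemma P_mult: "x \<in> P m \<Longrightarrow> y \<in> P n \<Longrightarrow> x * y \<in> P (m + n)"
  using w_mult[of x y] by (cases "x = 0"; cases "y = 0") (auto simp: val_ge_def)

lemma P_mult_0: "x \<in> P 0 \<Longrightarrow> y \<in> P n \<Longrightarrow> x * y \<in> P n"
  using P_mult[of x 0 y n] by simp

lemma P_power: "x \<in> P n \<Longrightarrow> x ^ j \<in> P (int j * n)"
  by (induction j) (auto simp: P_1 algebra_simps intro: P_mult[of x n _ "int j * n" for j, simplified])

lemma P_sum: "(\<And>i. i \<in> S \<Longrightarrow> f i \<in> P n) \<Longrightarrow> sum f S \<in> P n"
  by (induction S rule: infinite_finite_induct) (auto intro: P_add)

lemma P_of_int: "of_int n \<in> P 0"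
proof -
  have "of_nat m \<in> P 0" for m by (induction m) (auto intro: P_add P_1)
  then show ?thesis by (cases n rule: int_cases2) (auto intro: P_uminus)
qed

lemma P_numeral: "numeral n \<in> P 0" using P_of_int[of "numeral n"] by simp

lemma P_divide: "x \<in> P m \<Longrightarrow> y \<in> k \<Longrightarrow> y \<noteq> 0 \<Longrightarrow> x / y \<in> P (m - w y)"
  by (cases "x = 0") (auto simp: val_ge_def w_divide)

lemma P_square_iff: "x \<in> k \<Longrightarrow> x\<^sup>2 \<in> P n \<longleftrightarrow> x \<in> P ((n + 1) div 2)"
  by (cases "x = 0") (auto simp: val_ge_def w_power)

lemma w_add_eq:
  assumes "x \<in> k" "x \<noteq> 0" "y \<in> P (w x + 1)"
  shows "x + y \<noteq> 0" "w (x + y) = w x"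
proof -
  show nz: "x + y \<noteq> 0"
  proof
    assume "x + y = 0"
    then have "y = - x" by (simp add: eq_neg_iff_add_eq_0 add.commute)
    then show False using assms by (auto simp: val_ge_def)
  qed
  have "x + y \<in> P (w x)"
    using assms by (intro P_add) (auto simp: val_ge_def)
  moreover have "\<not> w x < w (x + y)"
  proof
    assume "w x < w (x + y)"
    then have "x + y \<in> P (w x + 1)" using assms nz by (auto simp: val_ge_def)
    from P_diff[OF this assms(3)] show False using assms by (auto simp: val_ge_def)
  qed
  ultimately show "w (x + y) = w x" using nz by (auto simp: val_ge_def)
qed

lemma P_add_neq:
  assumes "x \<in> k" "y \<in> k" "x \<noteq> 0" "y \<noteq> 0" "w x \<noteq> w y"
  shows "x + y \<noteq> 0" "w (x + y) = min (w x) (w y)"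
proof -
  consider "w x < w y" | "w y < w x" using assms by linarith
  then have "x + y \<noteq> 0 \<and> w (x + y) = min (w x) (w y)"
  proof cases
    case 1
    then show ?thesis using w_add_eq[of x y] assms by (auto simp: val_ge_def)
  next
    case 2
    then show ?thesis using w_add_eq[of y x] assms by (auto simp: val_ge_def add.commute)
  qed
  then show "x + y \<noteq> 0" "w (x + y) = min (w x) (w y)" by auto
qed

lemma P_inj:
  assumes "p \<in> k" "p \<noteq> 0" "w p = 1" "P m = P n" shows "m = n"
proof -
  have iff: "p powi i \<in> P j \<longleftrightarrow> j \<le> i" for i j using assms by (simp add: P_iff w_power_int)
  have "p powi m \<in> P n" using iff[of m m] unfolding assms(4) by simp
  moreover have "p powi n \<in> P m" using iff[of n n] unfolding assms(4) by simp
  ultimately show ?thesis using iff by simp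
qed

text \<open>If \<open>w x\<close> were negative, the leading term of \<open>p\<close> would have
  strictly smaller valuation than the sum of all the others and could not cancel against it.\<close>

lemma integral_closed:
  assumes x: "x \<in> k" and p: "lead_coeff p = 1" "coeffs_in (P 0) p" "poly p x = 0"
  shows "x \<in> P 0"
proof (rule ccontr)
  assume "x \<notin> P 0"
  then have nz: "x \<noteq> 0" and neg: "w x < 0" using x by (auto simp: val_ge_def)
  have xpow: "x ^ i \<in> P (int i * w x)" for i using x nz by (simp add: val_ge_def w_power)
  have "(\<Sum>i<degree p. coeff p i * x ^ i) \<in> P (int (degree p) * w x + 1)"
  proof (intro P_sum P_mult_0)
    fix i assume "i \<in> {..<degree p}"
    then have "int i + 1 \<le> int (degree p)" by simp
    then have "int (degree p) * w x \<le> (int i + 1) * w x"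
      using neg by (intro mult_right_mono_neg) auto
    then have "int (degree p) * w x + 1 \<le> int i * w x" using neg by (simp add: algebra_simps)
    with xpow show "x ^ i \<in> P (int (degree p) * w x + 1)" by (rule P_mono)
  qed (use p in \<open>auto simp: coeffs_in_def\<close>)
  moreover have "poly p x = (\<Sum>i<degree p. coeff p i * x ^ i) + x ^ degree p"
    using p(1) by (simp add: poly_altdef lessThan_Suc_atMost[symmetric])
  then have "(\<Sum>i<degree p. coeff p i * x ^ i) = - (x ^ degree p)"
    using p(3) by (simp add: eq_neg_iff_add_eq_0)
  ultimately show False using x nz by (auto simp: val_ge_def w_power)
qed

lemma int_ring_self: "int_ring (P 0) k = P 0"
proof
  show "P 0 \<subseteq> int_ring (P 0) k"
  proof
    fix x assume x: "x \<in> P 0"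
    have "coeffs_in (P 0) [:- x, 1:]"
      using P_uminus[OF x] P_1 by (auto simp: coeffs_in_def coeff_pCons split: nat.splits)
    moreover have "lead_coeff [:- x, 1:] = 1" "poly [:- x, 1:] x = 0" by simp_all
    ultimately show "x \<in> int_ring (P 0) k" using P_k[OF x] unfolding int_ring_def by blast
  qed
qed (use integral_closed in \<open>auto simp: int_ring_def\<close>)

lemma is_ideal_P: "0 \<le> n \<Longrightarrow> is_ideal (P 0) (P n)"
  by (auto simp: is_ideal_def intro: P_add P_mult_0 P_mono)

text \<open>An element \<open>s\<close> of minimal valuation already generates:
  \<open>x = (x / s) * s\<close> with \<open>x / s\<close> integral.\<close>

lemma ideal_gen_eq_P:
  assumes "0 \<le> n" "S \<subseteq> P n" "s \<in> S" "s \<noteq> 0" "w s = n"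
  shows "ideal_gen (P 0) S = P n"
proof
  show "ideal_gen (P 0) S \<subseteq> P n" using assms is_ideal_P unfolding ideal_gen_def by blast
  show "P n \<subseteq> ideal_gen (P 0) S"
    unfolding ideal_gen_def
  proof clarify
    fix x I assume x: "x \<in> P n" and I: "is_ideal (P 0) I" "S \<subseteq> I"
    have "x / s \<in> P 0" using P_divide[OF x, of s] assms P_k by auto
    then have "x / s * s \<in> I" using I assms unfolding is_ideal_def by blast
    then show "x \<in> I" using assms by simp
  qed
qed

lemma prime_ideal_eq_P:
  assumes "int_ring R k = P 0" shows "prime_ideal R k = P 1"
proof -
  have unit: "(\<exists>y\<in>P 0. x * y = 1) \<longleftrightarrow> x \<noteq> 0 \<and> w x = 0" if x: "x \<in> P 0" for x
  proof
    assume "\<exists>y\<in>P 0. x * y = 1"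
    then obtain y where y: "y \<in> P 0" "x * y = 1" by auto
    then have "w x + w y = 0" using w_mult[of x y] x by (cases "x = 0"; cases "y = 0") (auto simp: val_ge_def)
    then show "x \<noteq> 0 \<and> w x = 0" using x y by (auto simp: val_ge_def)
  next
    assume "x \<noteq> 0 \<and> w x = 0"
    then show "\<exists>y\<in>P 0. x * y = 1"
      using x by (intro bexI[of _ "inverse x"]) (auto simp: val_ge_def w_inverse)
  qed
  show ?thesis
  proof (rule Set.set_eqI)
    fix x
    have "x \<in> prime_ideal R k \<longleftrightarrow> x \<in> P 0 \<and> \<not> (\<exists>y\<in>P 0. x * y = 1)"
      by (simp only: prime_ideal_def assms mem_Collect_eq)
    also have "\<dots> \<longleftrightarrow> x \<in> P 0 \<and> \<not> (x \<noteq> 0 \<and> w x = 0)" using unit[of x] by argo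
    also have "\<dots> \<longleftrightarrow> x \<in> P 1" by (auto simp: val_ge_def)
    finally show "x \<in> prime_ideal R k \<longleftrightarrow> x \<in> P 1" .
  qed
qed

lemma prime_pow_eq_P:
  assumes "int_ring R k = P 0" "p \<in> k" "p \<noteq> 0" "w p = 1"
  shows "prime_pow R k n = P (int n)"
proof -
  have "ideal_pow (P 0) (P 1) n = P (int n)"
  proof (induction n)
    case (Suc n)
    show ?case
      unfolding ideal_pow.simps Suc
    proof (rule ideal_gen_eq_P[where s = "p * p ^ n"])
      show "{x * y |x y. x \<in> P 1 \<and> y \<in> P (int n)} \<subseteq> P (int (Suc n))"
        using P_mult[of _ 1 _ "int n"] by auto
      show "p * p ^ n \<in> {x * y |x y. x \<in> P 1 \<and> y \<in> P (int n)}"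
        using assms by (force simp: val_ge_def w_power)
    qed (use assms in \<open>auto simp: w_mult w_power\<close>)
  qed simp
  then show ?thesis using assms(1) prime_ideal_eq_P[OF assms(1)] by simp
qed

end

section \<open>Complete dyadic fields with perfect residue field\<close>

text \<open>By \<open>w_2\<close> the residue field has characteristic 2, and \<open>perfect\<close>
  says that squaring is onto there. These axioms pass to ramified quadratic extensions
  (\<open>dyadic_field_L\<close>), so one theory serves both \<open>K\<close> and \<open>k2\<close>
  as base field.\<close>

locale dyadic_field = valued_subfield +
  assumes surj: "\<exists>p\<in>k. p \<noteq> 0 \<and> w p = 1"
    and complete: "\<lbrakk>\<And>n. s n \<in> k; \<And>N. \<exists>M::nat. \<forall>m\<ge>M. \<forall>n\<ge>M. s m - s n \<in> val_ge k w N\<rbrakk>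
          \<Longrightarrow> \<exists>l\<in>k. \<forall>N. \<exists>M. \<forall>n\<ge>M. s n - l \<in> val_ge k w N"
    and w_2: "0 < w 2"
    and perfect: "x \<in> val_ge k w 0 \<Longrightarrow> \<exists>c\<in>val_ge k w 0. x - c\<^sup>2 \<in> val_ge k w 1"
begin

lemma exists_val: "\<exists>p\<in>k. p \<noteq> 0 \<and> w p = n"
proof -
  obtain p where "p \<in> k" "p \<noteq> 0" "w p = 1" using surj by auto
  then show ?thesis by (intro bexI[of _ "p powi n"]) (auto simp: w_power_int)
qed

lemma P_inject [simp]: "P m = P n \<longleftrightarrow> m = n"
  using surj P_inj by blast

lemma prime_pow_P: "int_ring R k = P 0 \<Longrightarrow> prime_pow R k n = P (int n)"
  using surj prime_pow_eq_P by blast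

lemma P_numeral_2: "2 \<in> P 1" using w_2 by (auto simp: val_ge_def)

lemma eq_0_if_all_P:
  assumes "\<And>N. x \<in> P N" shows "x = 0"
  using assms[of "w x + 1"] by (auto simp: val_ge_def)

lemma P_telescope:
  assumes "\<And>n. s (Suc n) - s n \<in> P (int n)" "m \<le> n"
  shows "s n - s m \<in> P (int m)"
  using assms(2)
proof (induction n rule: dec_induct)
  case (step n)
  have "s (Suc n) - s n \<in> P (int m)" using P_mono[OF assms(1)[of n]] step by simp
  from P_add[OF this step.IH] show ?case by simp
qed simp

text \<open>Hensel's lemma for \<open>y\<^sup>2 + y + c\<close>: the iteration \<open>y \<mapsto> - c - y\<^sup>2\<close> is a contraction.\<close>

lemma artin_schreier_root:
  assumes c: "c \<in> P 1"
  shows "\<exists>y\<in>k. y\<^sup>2 + y + c = 0"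
proof -
  define s where "s = rec_nat 0 (\<lambda>_ y. - c - y\<^sup>2)"
  have s_Suc: "s (Suc n) = - c - (s n)\<^sup>2" for n by (simp add: s_def)
  have s1: "s n \<in> P 1" for n
  proof (induction n)
    case (Suc n)
    have "(s n)\<^sup>2 \<in> P 1" using P_mult[OF Suc Suc] by (auto simp: power2_eq_square intro: P_mono)
    then show ?case using c by (auto simp: s_Suc intro!: P_diff P_uminus)
  qed (simp add: s_def)
  have step: "s (Suc n) - s n \<in> P (int n)" for n
  proof (induction n)
    case 0
    show ?case using P_mono[OF P_diff[OF s1[of "Suc 0"] s1[of 0]], of 0] by simp
  next
    case (Suc n)
    have c: "c = - s (Suc n) - (s n)\<^sup>2" by (simp add: s_Suc)
    have "s (Suc (Suc n)) - s (Suc n) = - ((s (Suc n) - s n) * (s (Suc n) + s n))"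
      unfolding s_Suc[of "Suc n"] by (subst c) (simp add: power2_eq_square algebra_simps)
    \<comment> \<open>The contraction: the second factor lies in \<open>P 1\<close> and gains one
      power in every step.\<close>
    moreover have "(s (Suc n) - s n) * (s (Suc n) + s n) \<in> P (int n + 1)"
      using Suc P_add[OF s1 s1] by (rule P_mult)
    ultimately show ?case using P_uminus by (simp add: add.commute)
  qed
  have "\<exists>l\<in>k. \<forall>N. \<exists>M. \<forall>n\<ge>M. s n - l \<in> P N"
  proof (rule complete)
    fix N
    have "s m - s n \<in> P N" if "m \<ge> nat N" "n \<ge> nat N" for m n
    proof -
      have "s m - s (nat N) \<in> P (int (nat N))" "s n - s (nat N) \<in> P (int (nat N))"
        by (rule P_telescope[of s, OF step], use that in simp)+
      from P_diff[OF this] show ?thesis by (auto intro: P_mono)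
    qed
    then show "\<exists>M. \<forall>m\<ge>M. \<forall>n\<ge>M. s m - s n \<in> P N" by blast
  qed (use s1 P_k in blast)
  then obtain l where l: "l \<in> k" and lim: "\<And>N. \<exists>M. \<forall>n\<ge>M. s n - l \<in> P N" by blast
  have "l\<^sup>2 + l + c \<in> P N" for N
  proof -
    \<comment> \<open>The maximum with 0 ensures that the limit \<open>l\<close> is integral even
      when \<open>N\<close> is negative.\<close>
    obtain M where M: "\<And>n. n \<ge> M \<Longrightarrow> s n - l \<in> P (max N 0)" using lim by blast
    have a: "s M - l \<in> P (max N 0)" "s (Suc M) - l \<in> P (max N 0)" using M by auto
    have "l \<in> P 0"
      using P_diff[OF P_mono[OF s1[of M], of 0] P_mono[OF a(1), of 0]] by simp
    then have "s M + l \<in> P 0" using P_add[OF P_mono[OF s1[of M], of 0]] by simp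
    then have "(s M + l) * (s M - l) \<in> P (max N 0)" using a by (auto intro: P_mult_0)
    from P_diff[OF P_uminus[OF this] a(2)]
    have "- ((s M + l) * (s M - l)) - (s (Suc M) - l) \<in> P (max N 0)" .
    also have "- ((s M + l) * (s M - l)) - (s (Suc M) - l) = l\<^sup>2 + l + c"
      by (simp add: s_Suc power2_eq_square algebra_simps)
    finally show ?thesis by (rule P_mono) simp
  qed
  then show ?thesis using eq_0_if_all_P l by blast
qed

text \<open>The substitution \<open>x = - T y\<close> turns the polynomial into
  \<open>T^2 (y^2 + y + n / T^2)\<close>, whose constant term in the bracket lies in
  \<open>P 1\<close>.\<close>

lemma quadratic_root:
  assumes "T \<in> k" "T \<noteq> 0" "n \<in> P (2 * w T + 1)"
  shows "\<exists>x\<in>k. x\<^sup>2 - T * x + n = 0"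
proof -
  have "n / T\<^sup>2 \<in> P 1" using P_divide[OF assms(3), of "T\<^sup>2"] assms by (auto simp: w_power)
  then obtain y where y: "y \<in> k" "y\<^sup>2 + y + n / T\<^sup>2 = 0" using artin_schreier_root by blast
  have "(- (T * y))\<^sup>2 - T * (- (T * y)) + n = T\<^sup>2 * (y\<^sup>2 + y + n / T\<^sup>2)"
    using assms by (simp add: field_simps power2_eq_square)
  then show ?thesis using y assms by (intro bexI[of _ "- (T * y)"]) auto
qed

end

section \<open>Quadratic extensions\<close>

lemma det_2:
  fixes A :: "'a::comm_ring_1 mat"
  assumes "A \<in> carrier_mat 2 2"
  shows "det A = A $$ (0, 0) * A $$ (1, 1) - A $$ (0, 1) * A $$ (1, 0)"
proof -
  have "det (mat_delete A 0 0) = A $$ (1, 1)" "det (mat_delete A 1 0) = A $$ (0, 1)"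
    using assms by (subst det_single; auto simp: mat_delete_def)+
  then show ?thesis
    using assms laplace_expansion_column[of A 2 0]
    by (simp add: cofactor_def numeral_2_eq_2 algebra_simps)
qed

section \<open>Bases and invariance of dimension\<close>

lemma is_basis_span:
  "is_basis k L n b \<Longrightarrow> x \<in> L \<Longrightarrow> \<exists>c. (\<forall>i<n. c i \<in> k) \<and> x = (\<Sum>i<n. c i * b i)"
  by (simp add: is_basis_def)

lemma is_basis_indep:
  assumes "is_basis k L n b" "\<And>i. i < n \<Longrightarrow> c i \<in> k" "(\<Sum>i<n. c i * b i) = 0" "i < n"
  shows "c i = 0"
proof -
  have "\<forall>c. (\<forall>i<n. c i \<in> k) \<and> (\<Sum>i<n. c i * b i) = 0 \<longrightarrow> (\<forall>i<n. c i = 0)"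
    using assms(1) by (simp add: is_basis_def)
  then show ?thesis using assms(2-4) by metis
qed

lemma is_basis_transition:
  assumes "is_basis k L n b" "is_basis k L m c"
  shows "\<exists>P. (\<forall>j<m. \<forall>i<n. P j i \<in> k) \<and> (\<forall>j<m. c j = (\<Sum>i<n. P j i * b i))"
proof -
  have "\<forall>j\<in>{..<m}. \<exists>p. (\<forall>i<n. p i \<in> k) \<and> c j = (\<Sum>i<n. p i * b i)"
    using assms unfolding is_basis_def by auto
  then obtain P where "\<forall>j\<in>{..<m}. (\<forall>i<n. P j i \<in> k) \<and> c j = (\<Sum>i<n. P j i * b i)"
    by (rule bchoice[THEN exE])
  then show ?thesis by (intro exI[of _ P]) auto
qed

text \<open>The trace of a product of transition matrices does not depend on the order of the factors.\<close>

lemma is_basis_dim_unique: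
  fixes k :: "'a::field_char_0 set"
  assumes k: "is_subfield k" and b: "is_basis k L n b" and c: "is_basis k L m c"
  shows "n = m"
proof -
  have tr: "(\<Sum>i<n. \<Sum>j<m. Q i j * P j i) = of_nat n"
    if b: "is_basis k L n b"
      and P: "\<And>i j. j < m \<Longrightarrow> i < n \<Longrightarrow> P j i \<in> k" "\<And>j. j < m \<Longrightarrow> c j = (\<Sum>i<n. P j i * b i)"
      and Q: "\<And>i j. j < m \<Longrightarrow> i < n \<Longrightarrow> Q i j \<in> k" "\<And>i. i < n \<Longrightarrow> b i = (\<Sum>j<m. Q i j * c j)"
    for n m P Q and b c :: "nat \<Rightarrow> 'a"
  proof -
    have "(\<Sum>j<m. Q i j * P j i) = 1" if i: "i < n" for i
    proof -
      \<comment> \<open>Row \<open>i\<close> of the product of the two transition matrices minus the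
        identity; independence of \<open>b\<close> will make it vanish.\<close>
      define r where "r = (\<lambda>l. (\<Sum>j<m. Q i j * P j l) - (if l = i then 1 else 0))"
      have "(\<Sum>l<n. r l * b l) = (\<Sum>l<n. \<Sum>j<m. Q i j * P j l * b l) - b i"
        using i by (simp add: r_def left_diff_distrib sum_subtractf sum_distrib_right
            if_distrib[of "\<lambda>x. x * _"] sum.delta cong: if_cong)
      also have "(\<Sum>l<n. \<Sum>j<m. Q i j * P j l * b l) = (\<Sum>j<m. Q i j * (\<Sum>l<n. P j l * b l))"
        by (subst sum.swap) (simp add: sum_distrib_left mult.assoc)
      also have "\<dots> = (\<Sum>j<m. Q i j * c j)"
        using P by (intro sum.cong) auto
      also have "\<dots> = b i" using Q i by simp
      finally have "(\<Sum>l<n. r l * b l) = 0" by simp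
      moreover have "r l \<in> k" if "l < n" for l
        using P Q i k that by (auto simp: r_def intro!: subfield_diff subfield_mult
            subfield_0 subfield_1 subfield_sum)
      ultimately have "r i = 0" using is_basis_indep[OF b _ _ i] by blast
      then show ?thesis using i by (auto simp: r_def)
    qed
    then show ?thesis by simp
  qed
  obtain P where P: "\<And>i j. j < m \<Longrightarrow> i < n \<Longrightarrow> P j i \<in> k" "\<And>j. j < m \<Longrightarrow> c j = (\<Sum>i<n. P j i * b i)"
    using is_basis_transition[OF b c] by blast
  obtain Q where Q: "\<And>i j. j < m \<Longrightarrow> i < n \<Longrightarrow> Q i j \<in> k" "\<And>i. i < n \<Longrightarrow> b i = (\<Sum>j<m. Q i j * c j)"
    using is_basis_transition[OF c b] by blast
  have "of_nat n = (\<Sum>i<n. \<Sum>j<m. Q i j * P j i)" using tr[OF b P Q] by simp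
  also have "\<dots> = (\<Sum>j<m. \<Sum>i<n. P j i * Q i j)" by (subst sum.swap) (simp add: mult.commute)
  also have "\<dots> = of_nat m" using tr[OF c Q P] by simp
  finally show ?thesis by simp
qed

lemma monic_quadratic_solve: "a = b - c" if "a - b + c = 0" for a b c :: "'a::ab_group_add"
proof -
  have "a = (a - b + c) + (b - c)" by simp
  then show ?thesis using that by simp
qed

section \<open>Trace and norm in a quadratic extension\<close>

locale quadratic =
  fixes k L :: "'a::field_char_0 set"
  assumes ext: "extension_of_degree k L 2"
begin

lemma sub_k: "is_subfield k" and sub_L: "is_subfield L" and k_L: "x \<in> k \<Longrightarrow> x \<in> L"
  using ext by (auto simp: extension_of_degree_def)

lemmas [simp] = subfield_intros[OF sub_k] subfield_intros[OF sub_L]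

abbreviation Tr :: "'a \<Rightarrow> 'a" where "Tr \<equiv> field_trace k L"
abbreviation N :: "'a \<Rightarrow> 'a" where "N \<equiv> field_norm k L"

lemma exists_generator: "\<exists>x\<in>L. x \<notin> k"
proof (rule ccontr)
  assume "\<not> (\<exists>x\<in>L. x \<notin> k)"
  then have "is_basis k L 1 (\<lambda>_. 1)" by (auto simp: is_basis_def)
  moreover obtain b where "is_basis k L 2 b" using ext by (auto simp: extension_of_degree_def)
  ultimately show False using is_basis_dim_unique[OF sub_k] by fastforce
qed

lemma indep:
  assumes "x \<notin> k" "a \<in> k" "b \<in> k" "a' \<in> k" "b' \<in> k" "a + b * x = a' + b' * x"
  shows "a = a'" "b = b'"
proof -
  have "(b - b') * x = a' - a" using assms by (simp add: algebra_simps)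
  then have "b \<noteq> b' \<Longrightarrow> x = (a' - a) / (b - b')" by (simp add: field_simps)
  then show "b = b'" using assms by (metis subfield_diff[OF sub_k] subfield_divide[OF sub_k])
  then show "a = a'" using assms by simp
qed

lemma generator_span:
  assumes x: "x \<in> L" "x \<notin> k" and y: "y \<in> L"
  obtains a b where "a \<in> k" "b \<in> k" "y = a + b * x"
proof -
  obtain c where c: "is_basis k L 2 c" using ext by (auto simp: extension_of_degree_def)
  have "\<exists>p q. p \<in> k \<and> q \<in> k \<and> z = p * c 0 + q * c 1" if z: "z \<in> L" for z
  proof -
    obtain d where "\<forall>i<2. d i \<in> k" "z = (\<Sum>i<2. d i * c i)"
      using is_basis_span[OF c z] by metis
    then show ?thesis by (intro exI[of _ "d 0"] exI[of _ "d 1"]) (simp add: numeral_2_eq_2)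
  qed
  then obtain p q p' q' r s where k: "p \<in> k" "q \<in> k" "p' \<in> k" "q' \<in> k" "r \<in> k" "s \<in> k"
    and x': "x = p * c 0 + q * c 1" and one: "1 = p' * c 0 + q' * c 1" and y': "y = r * c 0 + s * c 1"
    using x y subfield_1[OF sub_L] by metis
  \<comment> \<open>The determinant of the coordinates of \<open>x\<close> and \<open>1\<close>; if
    it vanished, \<open>x\<close> would be a multiple of \<open>1\<close> over
    \<open>k\<close>.\<close>
  define D where "D = p * q' - q * p'"
  have "D \<noteq> 0"
  proof
    assume D: "D = 0"
    have "q' * x - q * 1 = D * c 0" by (subst x', subst one) (simp add: D_def algebra_simps)
    then have q: "q' * x = q" using D by simp
    have "x = q / q'" if "q' \<noteq> 0" using q that by (simp add: field_simps)
    then have "q' = 0" using k x subfield_divide[OF sub_k] by metis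
    have "p' * x = p * (p' * c 0)" using x' q \<open>q' = 0\<close> by simp
    moreover have "p' * c 0 = 1" using one \<open>q' = 0\<close> by simp
    ultimately have "p' * x = p" by simp
    moreover have "p' \<noteq> 0" using one \<open>q' = 0\<close> by auto
    ultimately have "x = p / p'" by (simp add: field_simps)
    then show False using k x by auto
  qed
  \<comment> \<open>Cramer's rule.\<close>
  define a b where "a = (p * s - q * r) / D" and "b = (r * q' - s * p') / D"
  have "a \<in> k" "b \<in> k" using k by (auto simp: a_def b_def D_def)
  moreover have "D * (a + b * x) = D * y"
  proof -
    have "D * a = p * s - q * r" "D * b = r * q' - s * p'" using \<open>D \<noteq> 0\<close> by (auto simp: a_def b_def)
    then have "D * (a + b * x) = (p * s - q * r) * 1 + (r * q' - s * p') * x"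
      by (simp add: distrib_left flip: mult.assoc)
    also have "\<dots> = D * y" by (subst one, subst x', subst y') (simp add: D_def algebra_simps)
    finally show ?thesis .
  qed
  then have "y = a + b * x" using \<open>D \<noteq> 0\<close> by simp
  ultimately show ?thesis using that by blast
qed

lemma generator_basis:
  assumes "x \<in> L" "x \<notin> k"
  shows "is_basis k L 2 (\<lambda>i. if i = 0 then 1 else x)"
  unfolding is_basis_def
proof (intro conjI ballI allI impI)
  fix y assume "y \<in> L"
  then obtain a b where "a \<in> k" "b \<in> k" "y = a + b * x" using generator_span[OF assms] by metis
  then show "\<exists>c. (\<forall>i<2. c i \<in> k) \<and> y = (\<Sum>i<2::nat. c i * (if i = 0 then 1 else x))"
    by (intro exI[of _ "\<lambda>i. if i = 0 then a else b"]) (auto simp: numeral_2_eq_2)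
next
  fix c :: "nat \<Rightarrow> 'a" and i :: nat
  assume "(\<forall>i<2. c i \<in> k) \<and> (\<Sum>i<2. c i * (if i = 0 then 1 else x)) = 0" and i: "i < 2"
  then have "c 0 \<in> k" "c 1 \<in> k" "c 0 + c 1 * x = 0 + 0 * x" by (auto simp: numeral_2_eq_2)
  then have "c 0 = 0" "c 1 = 0" using indep[OF assms(2), of "c 0" "c 1" 0 0] by simp_all
  then show "c i = 0" using i by (auto simp: numeral_2_eq_2 less_Suc_eq)
qed (use assms in auto)

text \<open>Every multiplication matrix of \<open>x\<close>, in whatever basis, has the same trace
  and determinant. For \<open>x\<close> outside \<open>k\<close> this follows by comparing the
  characteristic equation with the given quadratic one, since \<open>1, x\<close> are independent;
  for \<open>x\<close> in \<open>k\<close> the matrix is scalar.\<close>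

lemma mult_matrix_charpoly:
  assumes x: "x \<in> L" and M: "is_mult_matrix k L n b x M"
  shows "n = 2"
    "x \<notin> k \<Longrightarrow> T \<in> k \<Longrightarrow> c \<in> k \<Longrightarrow> x\<^sup>2 - T * x + c = 0 \<Longrightarrow> (\<Sum>i<n. M $$ (i, i)) = T \<and> det M = c"
    "x \<in> k \<Longrightarrow> (\<Sum>i<n. M $$ (i, i)) = 2 * x \<and> det M = x\<^sup>2"
proof -
  obtain e where "is_basis k L 2 e" using ext by (auto simp: extension_of_degree_def)
  then show n: "n = 2" using is_basis_dim_unique[OF sub_k, of L n b] M by (simp add: is_mult_matrix_def)
  have b: "is_basis k L 2 b" and dim: "M \<in> carrier_mat 2 2"
    and Mk: "M $$ (0, 0) \<in> k" "M $$ (0, 1) \<in> k" "M $$ (1, 0) \<in> k" "M $$ (1, 1) \<in> k"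
    and eq: "x * b 0 = M $$ (0, 0) * b 0 + M $$ (1, 0) * b 1"
      "x * b 1 = M $$ (0, 1) * b 0 + M $$ (1, 1) * b 1"
    using M unfolding is_mult_matrix_def n by (auto simp: numeral_2_eq_2)
  have tr: "(\<Sum>i<n. M $$ (i, i)) = M $$ (0, 0) + M $$ (1, 1)" by (simp add: n numeral_2_eq_2)
  have zero: "p = 0 \<and> q = 0" if "p \<in> k" "q \<in> k" "p * b 0 + q * b 1 = 0" for p q
    using is_basis_indep[OF b, of "\<lambda>i. if i = 0 then p else q" 0]
      is_basis_indep[OF b, of "\<lambda>i. if i = 0 then p else q" 1] that
    by (auto simp: numeral_2_eq_2)
  show "(\<Sum>i<n. M $$ (i, i)) = 2 * x \<and> det M = x\<^sup>2" if "x \<in> k"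
  proof -
    have "M $$ (0, 0) - x = 0 \<and> M $$ (1, 0) = 0" "M $$ (0, 1) = 0 \<and> M $$ (1, 1) - x = 0"
      using eq Mk that by (intro zero; simp add: algebra_simps)+
    then show ?thesis unfolding tr det_2[OF dim] by (simp add: power2_eq_square)
  qed
  show "(\<Sum>i<n. M $$ (i, i)) = T \<and> det M = c"
    if "x \<notin> k" "T \<in> k" "c \<in> k" "x\<^sup>2 - T * x + c = 0"
  proof -
    \<comment> \<open>Cayley-Hamilton by hand: the characteristic polynomial of \<open>M\<close> at
      \<open>x\<close> annihilates the nonzero basis vector \<open>b 0\<close>.\<close>
    define S where "S = M $$ (0, 0) + M $$ (1, 1)"
    have "(x\<^sup>2 - S * x + det M) * b 0 = 0"
    proof -
      have "x * (x * b 0) - S * (x * b 0) + det M * b 0 = 0"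
        unfolding eq(1) distrib_left mult.left_commute[of x] eq
        unfolding det_2[OF dim] S_def by (simp add: algebra_simps)
      then show ?thesis by (simp add: algebra_simps power2_eq_square)
    qed
    moreover have "b 0 \<noteq> 0" using zero[of 1 0] by auto
    ultimately have "x\<^sup>2 - S * x + det M = 0" by simp
    then have "x\<^sup>2 = S * x - det M" by (rule monic_quadratic_solve)
    then have "- c + T * x = - det M + S * x" using monic_quadratic_solve[OF that(4)] by simp
    moreover have "S \<in> k" "det M \<in> k" using Mk unfolding S_def det_2[OF dim] by auto
    ultimately have "- c = - det M \<and> T = S"
      using indep[OF \<open>x \<notin> k\<close>, of "- c" T "- det M" S] that by simp
    then show ?thesis unfolding tr S_def by auto
  qed
qed

lemma exists_mult_matrix:
  assumes x: "x \<in> L" shows "\<exists>n b M. is_mult_matrix k L n b x M"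
proof -
  obtain g where g: "g \<in> L" "g \<notin> k" using exists_generator by blast
  obtain a b where ab: "a \<in> k" "b \<in> k" "x = a + b * g" using generator_span[OF g x] by blast
  have "x * g \<in> L" using x g by auto
  from generator_span[OF g this] obtain c d where cd: "c \<in> k" "d \<in> k" "x * g = c + d * g" by blast
  have "is_mult_matrix k L 2 (\<lambda>i. if i = 0 then 1 else g) x
    (mat 2 2 (\<lambda>(i, j). if j = 0 then (if i = 0 then a else b) else (if i = 0 then c else d)))"
    using generator_basis[OF g] ab cd
    unfolding is_mult_matrix_def by (auto simp: numeral_2_eq_2 less_Suc_eq)
  then show ?thesis by blast
qed

text \<open>Turns agreement of all multiplication matrices into values of the definite descriptions
  behind \<open>Tr\<close> and \<open>N\<close>.\<close>

lemma trace_norm_unique: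
  assumes x: "x \<in> L"
    and M: "\<And>n b M. is_mult_matrix k L n b x M \<Longrightarrow> (\<Sum>i<n. M $$ (i, i)) = T \<and> det M = c"
  shows "Tr x = T" "N x = c"
proof -
  obtain n b M where M': "is_mult_matrix k L n b x M" using exists_mult_matrix[OF x] by metis
  show "Tr x = T"
    unfolding field_trace_def
  proof (rule the_equality)
    show "\<exists>n b M. is_mult_matrix k L n b x M \<and> T = (\<Sum>i<n. M $$ (i, i))" using M' M by metis
  qed (use M in metis)
  show "N x = c"
    unfolding field_norm_def
  proof (rule the_equality)
    show "\<exists>n b M. is_mult_matrix k L n b x M \<and> c = det M" using M' M by metis
  qed (use M in metis)
qed

lemma
  assumes "x \<in> L" "x \<notin> k" "T \<in> k" "n \<in> k" "x\<^sup>2 - T * x + n = 0"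
  shows trace_eq: "Tr x = T" and norm_eq: "N x = n"
  by (rule trace_norm_unique; rule assms mult_matrix_charpoly(2); (rule assms | assumption))+

lemma
  assumes "x \<in> k"
  shows trace_base: "Tr x = 2 * x" and norm_base: "N x = x\<^sup>2"
  by (rule trace_norm_unique[OF k_L[OF assms] mult_matrix_charpoly(3)[OF k_L[OF assms] _ assms]], assumption)+

lemma
  assumes "x \<in> L"
  shows trace_k [simp]: "Tr x \<in> k" and norm_k [simp]: "N x \<in> k"
    and charpoly: "x\<^sup>2 - Tr x * x + N x = 0"
proof -
  have "Tr x \<in> k \<and> N x \<in> k \<and> x\<^sup>2 - Tr x * x + N x = 0"
  proof (cases "x \<in> k")
    case True
    then show ?thesis by (auto simp: trace_base norm_base power2_eq_square)
  next
    case False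
    have "x * x \<in> L" using assms by auto
    from generator_span[OF assms False this]
    obtain a b where ab: "a \<in> k" "b \<in> k" "x * x = a + b * x" by blast
    then have "x\<^sup>2 - b * x + - a = 0" by (simp add: power2_eq_square)
    then show ?thesis using trace_eq[OF assms False, of b "- a"] norm_eq[OF assms False, of b "- a"] ab
      by auto
  qed
  then show "Tr x \<in> k" "N x \<in> k" "x\<^sup>2 - Tr x * x + N x = 0" by auto
qed

lemma
  assumes "g \<in> L" "g \<notin> k" "a \<in> k" "b \<in> k"
  shows trace_gen: "Tr (a + b * g) = 2 * a + b * Tr g"
    and norm_gen: "N (a + b * g) = a\<^sup>2 + a * b * Tr g + b\<^sup>2 * N g"
proof -
  have "Tr (a + b * g) = 2 * a + b * Tr g \<and> N (a + b * g) = a\<^sup>2 + a * b * Tr g + b\<^sup>2 * N g"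
  proof (cases "b = 0")
    case True
    then show ?thesis using assms by (simp add: trace_base norm_base)
  next
    case False
    have L: "a + b * g \<in> L" using assms k_L by auto
    have nk: "a + b * g \<notin> k"
    proof
      assume "a + b * g \<in> k"
      then have "(a + b * g - a) / b \<in> k"
        using assms by (intro subfield_divide[OF sub_k] subfield_diff[OF sub_k])
      then show False using assms False by simp
    qed
    have "(a + b * g)\<^sup>2 - (2 * a + b * Tr g) * (a + b * g) + (a\<^sup>2 + a * b * Tr g + b\<^sup>2 * N g)
      = b\<^sup>2 * (g\<^sup>2 - Tr g * g + N g)" by (simp add: algebra_simps power2_eq_square)
    also have "\<dots> = 0" using charpoly assms by simp
    finally show ?thesis using assms by (intro conjI trace_eq[OF L nk] norm_eq[OF L nk]) auto
  qed
  then show "Tr (a + b * g) = 2 * a + b * Tr g" "N (a + b * g) = a\<^sup>2 + a * b * Tr g + b\<^sup>2 * N g"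
    by auto
qed

text \<open>In coordinates with respect to \<open>1, g\<close> the norm is a binary quadratic form,
  and multiplicativity is its composition identity.\<close>

lemma
  assumes "x \<in> L" "y \<in> L"
  shows trace_add: "Tr (x + y) = Tr x + Tr y" and norm_mult: "N (x * y) = N x * N y"
proof -
  obtain g where g: "g \<in> L" "g \<notin> k" using exists_generator by blast
  obtain a b c d where k: "a \<in> k" "b \<in> k" "c \<in> k" "d \<in> k" and x: "x = a + b * g" and y: "y = c + d * g"
    using generator_span[OF g] assms by metis
  have "x + y = (a + c) + (b + d) * g" using x y by (simp add: algebra_simps)
  then have "Tr (x + y) = 2 * (a + c) + (b + d) * Tr g" using k trace_gen[OF g] by simp
  then show "Tr (x + y) = Tr x + Tr y"
    unfolding x y trace_gen[OF g k(1,2)] trace_gen[OF g k(3,4)] by (simp add: algebra_simps)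
  have "x * y = a * c + (a * d + b * c) * g + b * d * g\<^sup>2"
    using x y by (simp add: algebra_simps power2_eq_square)
  also have "g\<^sup>2 = Tr g * g - N g" using charpoly[OF g(1)] by (simp add: algebra_simps)
  finally have "x * y = (a * c - b * d * N g) + (a * d + b * c + b * d * Tr g) * g"
    by (simp add: algebra_simps)
  then have "N (x * y) = (a * c - b * d * N g)\<^sup>2
      + (a * c - b * d * N g) * (a * d + b * c + b * d * Tr g) * Tr g
      + (a * d + b * c + b * d * Tr g)\<^sup>2 * N g"
    using k g by (simp add: norm_gen[OF g])
  also have "\<dots> = (a\<^sup>2 + a * b * Tr g + b\<^sup>2 * N g) * (c\<^sup>2 + c * d * Tr g + d\<^sup>2 * N g)"
    by (simp add: algebra_simps power2_eq_square)
  also have "\<dots> = N x * N y" using k x y by (simp add: norm_gen[OF g])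
  finally show "N (x * y) = N x * N y" .
qed

lemma trace_scale: "c \<in> k \<Longrightarrow> x \<in> L \<Longrightarrow> Tr (c * x) = c * Tr x"
  and norm_scale: "c \<in> k \<Longrightarrow> x \<in> L \<Longrightarrow> N (c * x) = c\<^sup>2 * N x"
proof -
  assume c: "c \<in> k" and x: "x \<in> L"
  show "N (c * x) = c\<^sup>2 * N x" using c x k_L by (simp add: norm_mult norm_base)
  show "Tr (c * x) = c * Tr x"
  proof (cases "x \<in> k")
    case True
    then show ?thesis using c by (simp add: trace_base)
  next
    case False
    then show ?thesis using trace_gen[OF x False, of 0 c] c by simp
  qed
qed

lemma norm_shift:
  assumes "c \<in> k" "x \<in> L" shows "N (x + c) = c\<^sup>2 + c * Tr x + N x"
proof (cases "x \<in> k")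
  case True
  then have "x + c \<in> k" using assms by auto
  then show ?thesis using True assms by (simp add: trace_base norm_base power2_eq_square algebra_simps)
next
  case False
  then show ?thesis using norm_gen[OF assms(2) False assms(1), of 1] by (simp add: add.commute)
qed

lemma trace_shift: "c \<in> k \<Longrightarrow> x \<in> L \<Longrightarrow> Tr (x + c) = Tr x + 2 * c"
  using k_L by (simp add: trace_add trace_base)

lemma norm_eq_0_iff: assumes "x \<in> L" shows "N x = 0 \<longleftrightarrow> x = 0"
proof
  assume N: "N x = 0"
  show "x = 0"
  proof (rule ccontr)
    assume nz: "x \<noteq> 0"
    have "inverse x \<in> L" using assms by auto
    from norm_mult[OF assms this] nz N have "N 1 = 0" by simp
    then show False by (simp add: norm_base)
  qed
qed (simp add: norm_base)

text \<open>Completing the square: \<open>2 * x - Tr x\<close> is a square root of the discriminant.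
  Such roots later generate the third quadratic field.\<close>

lemma trace_norm_diff_square:
  assumes "x \<in> L" shows "(2 * x - Tr x)\<^sup>2 = (Tr x)\<^sup>2 - 4 * N x"
proof -
  have "(2 * x - Tr x)\<^sup>2 = 4 * (x\<^sup>2 - Tr x * x + N x) + ((Tr x)\<^sup>2 - 4 * N x)"
    by (simp add: algebra_simps power2_eq_square)
  then show ?thesis using charpoly[OF assms] by simp
qed

lemma discr_nonzero:
  assumes "x \<in> L" "x \<notin> k" shows "(Tr x)\<^sup>2 - 4 * N x \<noteq> 0"
proof
  assume "(Tr x)\<^sup>2 - 4 * N x = 0"
  then have "2 * x - Tr x = 0" using trace_norm_diff_square[OF assms(1)] by simp
  then have "x = Tr x / 2" by (simp add: eq_divide_eq mult.commute)
  then show False using assms by (metis trace_k subfield_divide subfield_numeral sub_k)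
qed

end

section \<open>Adjoining a root of a quadratic polynomial\<close>

lemma extension_of_degree_2I:
  fixes k :: "'a::field_char_0 set"
  assumes "is_subfield k" "is_subfield L" "k \<subseteq> L" "x \<in> L" "x \<notin> k"
    and "\<And>y. y \<in> L \<Longrightarrow> \<exists>a\<in>k. \<exists>b\<in>k. y = a + b * x"
  shows "extension_of_degree k L 2"
proof -
  have "is_basis k L 2 (\<lambda>i. if i = 0 then 1 else x)"
    unfolding is_basis_def
  proof (intro conjI ballI allI impI)
    fix y assume "y \<in> L"
    then obtain a b where "a \<in> k" "b \<in> k" "y = a + b * x" using assms by blast
    then show "\<exists>c. (\<forall>i<2. c i \<in> k) \<and> y = (\<Sum>i<2::nat. c i * (if i = 0 then 1 else x))"
      by (intro exI[of _ "\<lambda>i. if i = 0 then a else b"]) (auto simp: numeral_2_eq_2)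
  next
    fix c :: "nat \<Rightarrow> 'a" and i :: nat
    assume "(\<forall>i<2. c i \<in> k) \<and> (\<Sum>i<2. c i * (if i = 0 then 1 else x)) = 0" and i: "i < 2"
    then have c: "c 0 \<in> k" "c 1 \<in> k" "c 0 + c 1 * x = 0" by (auto simp: numeral_2_eq_2)
    have "x = - c 0 / c 1" if "c 1 \<noteq> 0"
      using c(3) that by (simp add: field_simps eq_neg_iff_add_eq_0)
    then have "c 1 = 0" using c assms by (metis subfield_divide subfield_uminus)
    then have "c 0 = 0" using c by simp
    then show "c i = 0" using \<open>c 1 = 0\<close> i by (auto simp: numeral_2_eq_2 less_Suc_eq)
  qed (use assms subfield_1 in auto)
  then show ?thesis using assms by (auto simp: extension_of_degree_def)
qed

lemma quadratic_adjoin_subfield: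
  fixes k :: "'a::field_char_0 set"
  assumes k: "is_subfield k" and x: "x \<notin> k" "T \<in> k" "n \<in> k" "x\<^sup>2 - T * x + n = 0"
  shows "is_subfield {a + b * x | a b. a \<in> k \<and> b \<in> k}" (is "is_subfield ?L")
  unfolding is_subfield_def
proof (intro conjI ballI)
  note ki = subfield_intros[OF k]
  have mem: "a + b * x \<in> ?L" if "a \<in> k" "b \<in> k" for a b using that by auto
  have x2: "x * x = T * x - n" using monic_quadratic_solve[OF x(4)] by (simp add: power2_eq_square)
  show "0 \<in> ?L" by (rule CollectI, rule exI[of _ 0], rule exI[of _ 0]) (simp add: ki)
  show "1 \<in> ?L" by (rule CollectI, rule exI[of _ 1], rule exI[of _ 0]) (simp add: ki)
  fix y assume "y \<in> ?L"
  then obtain a b where y: "a \<in> k" "b \<in> k" "y = a + b * x" by auto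
  have "- y = - a + (- b) * x" using y by simp
  also have "\<dots> \<in> ?L" by (rule mem) (simp_all add: ki y)
  finally show "- y \<in> ?L" .
  show "inverse y \<in> ?L"
  proof (cases "y = 0")
    case True
    then show ?thesis using \<open>0 \<in> ?L\<close> by simp
  next
    case False
    \<comment> \<open>The norm of \<open>y\<close>: the inverse is the conjugate
      \<open>a + b (T - x)\<close> divided by \<open>D\<close>.\<close>
    define D where "D = a\<^sup>2 + a * b * T + b\<^sup>2 * n"
    have prod: "y * ((a + b * T) + (- b) * x) = D"
    proof -
      have "y * ((a + b * T) + (- b) * x) = a\<^sup>2 + a * b * T + b\<^sup>2 * (T * x - x * x)"
        by (simp add: y algebra_simps power2_eq_square)
      then show ?thesis by (simp add: x2 D_def algebra_simps)
    qed
    have "D \<noteq> 0"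
    proof
      assume "D = 0"
      then have *: "(a + b * T) + (- b) * x = 0" using prod False by simp
      have "x = (a + b * T) / b" if "b \<noteq> 0" using * that by (simp add: field_simps)
      moreover have "(a + b * T) / b \<in> k" using x y by (simp add: ki)
      ultimately have "b = 0" using x by metis
      then show False using * False y by simp
    qed
    then have "inverse y = ((a + b * T) + (- b) * x) / D"
      using prod False by (simp add: field_simps)
    also have "\<dots> = (a + b * T) / D + (- b / D) * x" by (simp add: add_divide_distrib diff_divide_distrib)
    also have "\<dots> \<in> ?L" by (rule mem) (simp_all add: ki y x D_def)
    finally show ?thesis .
  qed
  fix z assume "z \<in> ?L"
  then obtain c d where z: "c \<in> k" "d \<in> k" "z = c + d * x" by auto
  have "y + z = (a + c) + (b + d) * x" using y z by (simp add: algebra_simps)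
  also have "\<dots> \<in> ?L" by (rule mem) (simp_all add: ki y z)
  finally show "y + z \<in> ?L" .
  have "y * z = a * c + (a * d + b * c) * x + b * d * (x * x)" using y z by (simp add: algebra_simps)
  also have "\<dots> = (a * c - b * d * n) + (a * d + b * c + b * d * T) * x"
    by (simp add: x2 algebra_simps)
  also have "\<dots> \<in> ?L" by (rule mem) (simp_all add: ki y z x)
  finally show "y * z \<in> ?L" .
qed

lemma quadratic_adjoin:
  fixes k :: "'a::field_char_0 set"
  assumes k: "is_subfield k" and x: "x \<notin> k" "T \<in> k" "n \<in> k" "x\<^sup>2 - T * x + n = 0"
  shows "extension_of_degree k {a + b * x | a b. a \<in> k \<and> b \<in> k} 2"
    (is "extension_of_degree k ?L 2")
proof (rule extension_of_degree_2I[OF k quadratic_adjoin_subfield[OF assms], of x])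
  have "y = y + 0 * x" "x = 0 + 1 * x" for y by simp_all
  then show "k \<subseteq> ?L" "x \<in> ?L" using subfield_0[OF k] subfield_1[OF k] by blast+
qed (use x in auto)

section \<open>The valuation of a quadratic extension\<close>

locale quadratic_ext = dyadic_field k w + quadratic k L for k w L
begin

text \<open>By Hensel's lemma a polynomial \<open>z\<^sup>2 - T z + n\<close> with \<open>2 w(T) < w(n)\<close> splits.\<close>

lemma trace_bound:
  assumes x: "x \<in> L" and n: "N x \<in> P n" and T: "Tr x \<noteq> 0"
  shows "n \<le> 2 * w (Tr x)"
proof (cases "x \<in> k")
  case True
  then have "x \<noteq> 0" using T by (auto simp: trace_base)
  then have "w (Tr x) = w 2 + w x" "w (N x) = 2 * w x" "N x \<noteq> 0"
    using True by (auto simp: trace_base norm_base w_mult w_power)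
  then show ?thesis using w_2 n by (auto simp: val_ge_def)
next
  case False
  show ?thesis
  proof (rule ccontr)
    assume "\<not> n \<le> 2 * w (Tr x)"
    then have "N x \<in> P (2 * w (Tr x) + 1)" using P_mono[OF n] by simp
    then obtain y where y: "y \<in> k" "y\<^sup>2 - Tr x * y + N x = 0" using quadratic_root T x trace_k by metis
    \<comment> \<open>A root \<open>y\<close> in \<open>k\<close> brings along the second root
      \<open>Tr x - y\<close>, so \<open>x\<close> would itself lie in \<open>k\<close>.\<close>
    have "(x - y) * (x + y - Tr x) = (x\<^sup>2 - Tr x * x + N x) - (y\<^sup>2 - Tr x * y + N x)"
      by (simp add: algebra_simps power2_eq_square)
    also have "\<dots> = 0" using y charpoly[OF x] by simp
    finally have "x - y = 0 \<or> x + y - Tr x = 0" by (simp only: mult_eq_0_iff)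
    then have "x = y \<or> x = Tr x - y" by (auto simp: eq_diff_eq)
    moreover have "Tr x - y \<in> k" using x y by simp
    ultimately show False using False y by metis
  qed
qed

text \<open>The condition on \<open>j\<close> says that \<open>j\<close> is at most the ceiling of
  \<open>n / 2\<close>, the bound that \<open>trace_bound\<close> gives for the trace.\<close>

lemma trace_P: "x \<in> L \<Longrightarrow> N x \<in> P n \<Longrightarrow> 2 * j \<le> n + 1 \<Longrightarrow> Tr x \<in> P j"
  using trace_bound[of x n] by (cases "Tr x = 0") (auto simp: P_iff)

text \<open>Only the ultrametric inequality needs an argument. Dividing by the summand of smaller
  valuation reduces it to \<open>N (z + 1) = 1 + Tr z + N z\<close> being integral when
  \<open>N z\<close> is, and there the trace is controlled by Hensel's lemma.\<close>

sublocale val_L: valued_subfield L "\<lambda>x. w (field_norm k L x)"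
proof
  show "is_subfield L" by (rule sub_L)
next
  fix x y assume "x \<in> L" "y \<in> L" "x \<noteq> 0" "y \<noteq> 0"
  then show "w (N (x * y)) = w (N x) + w (N y)"
    by (simp add: norm_mult w_mult norm_eq_0_iff)
next
  have le: "w (N x) \<le> w (N (x + y))"
    if xy: "x \<in> L" "y \<in> L" "x \<noteq> 0" "y \<noteq> 0" "x + y \<noteq> 0" and le: "w (N x) \<le> w (N y)" for x y
  proof -
    define z where "z = y / x"
    have z: "z \<in> L" "z \<noteq> 0" "z + 1 \<noteq> 0" "x + y = x * (z + 1)" "y = x * z"
      using xy by (auto simp: z_def field_simps)
    then have "w (N y) = w (N x) + w (N z)"
      using xy by (simp add: norm_mult w_mult norm_eq_0_iff)
    then have N: "N z \<in> P 0" using le z by (simp add: P_iff norm_eq_0_iff)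
    have "N (z + 1) = 1 + Tr z + N z" using norm_shift[of 1 z] z by simp
    moreover have "1 + Tr z + N z \<in> P 0" using trace_P[OF z(1) N, of 0] N by (intro P_add P_1) auto
    ultimately have "N (z + 1) \<in> P 0" by simp
    then have "0 \<le> w (N (z + 1))" using z norm_eq_0_iff[of "z + 1"] by (simp add: val_ge_def)
    moreover have "w (N (x + y)) = w (N x) + w (N (z + 1))"
      using xy z by (simp add: norm_mult w_mult norm_eq_0_iff)
    ultimately show ?thesis by simp
  qed
  fix x y assume xy: "x \<in> L" "y \<in> L" "x \<noteq> 0" "y \<noteq> 0" "x + y \<noteq> 0"
  show "min (w (N x)) (w (N y)) \<le> w (N (x + y))"
  proof (cases "w (N x) \<le> w (N y)")
    case True
    then show ?thesis using le[of x y] xy by simp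
  next
    case False
    then show ?thesis using le[of y x] xy by (simp add: add.commute)
  qed
qed

abbreviation W :: "'a \<Rightarrow> int" where "W \<equiv> \<lambda>x. w (field_norm k L x)"
abbreviation PL :: "int \<Rightarrow> 'a set" where "PL \<equiv> val_ge L W"

lemma W_base: "x \<in> k \<Longrightarrow> x \<noteq> 0 \<Longrightarrow> W x = 2 * w x"
  by (simp add: norm_base w_power)

lemma PL_base: "x \<in> k \<Longrightarrow> x \<in> PL n \<longleftrightarrow> x \<in> P ((n + 1) div 2)"
  using W_base[of x] k_L[of x] by (cases "x = 0") (auto simp: val_ge_def)

lemma PL_iff_norm: "x \<in> L \<Longrightarrow> x \<in> PL n \<longleftrightarrow> N x \<in> P n"
  by (auto simp: val_ge_def norm_eq_0_iff)

lemma int_ring_L: "int_ring (P 0) L = PL 0"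
proof
  show "int_ring (P 0) L \<subseteq> PL 0"
  proof
    fix x assume "x \<in> int_ring (P 0) L"
    then obtain p where p: "x \<in> L" "lead_coeff p = 1" "coeffs_in (P 0) p" "poly p x = 0"
      unfolding int_ring_def by auto
    have "coeff p i \<in> PL 0" for i
    proof -
      have "coeff p i \<in> P 0" using p(3) by (simp add: coeffs_in_def)
      then show ?thesis using PL_base[OF P_k, of "coeff p i" 0 0] by simp
    qed
    then show "x \<in> PL 0" using p by (intro val_L.integral_closed[of x p]) (auto simp: coeffs_in_def)
  qed
  show "PL 0 \<subseteq> int_ring (P 0) L"
  proof
    fix x assume x: "x \<in> PL 0"
    then have L: "x \<in> L" by (rule val_L.P_k)
    have N: "N x \<in> P 0" using x PL_iff_norm[OF L] by simp
    have "Tr x \<in> P 0" using trace_P[OF L N] by simp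
    then have "coeffs_in (P 0) [:N x, - Tr x, 1:]"
      using N P_uminus P_1 by (auto simp: coeffs_in_def coeff_pCons split: nat.splits)
    moreover have "poly [:N x, - Tr x, 1:] x = 0"
      using charpoly[OF L] by (simp add: algebra_simps power2_eq_square)
    moreover have "lead_coeff [:N x, - Tr x, 1:] = 1" by simp
    ultimately show "x \<in> int_ring (P 0) L" using L unfolding int_ring_def by blast
  qed
qed

lemma uniformizer_not_base:
  assumes "t \<in> L" "t \<noteq> 0" "odd (W t)" shows "t \<notin> k"
  using W_base[of t] assms by auto

lemma scale_W:
  assumes "x \<in> L" "x \<noteq> 0"
  obtains c where "c \<in> k" "c \<noteq> 0" "w c = j" "W (c * x) = W x + 2 * j"
proof -
  obtain c where c: "c \<in> k" "c \<noteq> 0" "w c = j" using exists_val by blast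
  then have "W (c * x) = W x + 2 * j"
    using assms by (simp add: norm_scale w_mult w_power norm_eq_0_iff)
  then show ?thesis using that c by blast
qed

text \<open>\<open>a\<close> has even and \<open>b * t\<close> has odd valuation, so nothing cancels
  and both terms must lie in \<open>PL m\<close>. Solving \<open>2 w a \<ge> m\<close> and
  \<open>2 w b + 1 \<ge> m\<close> gives the two roundings.\<close>

lemma PL_uniformizer:
  assumes t: "t \<in> L" "t \<noteq> 0" "W t = 1" and ab: "a \<in> k" "b \<in> k"
  shows "a + b * t \<in> PL m \<longleftrightarrow> a \<in> P ((m + 1) div 2) \<and> b \<in> P (m div 2)"
proof -
  have b: "W (b * t) = 2 * w b + 1" if "b \<noteq> 0"
    using that t ab by (simp add: norm_scale w_mult w_power norm_eq_0_iff)
  have bt: "b * t \<in> PL m \<longleftrightarrow> b \<in> P (m div 2)"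
    using b t ab k_L by (cases "b = 0") (auto simp: val_ge_def)
  show ?thesis
  proof (cases "a = 0 \<or> b = 0")
    case True
    then show ?thesis using bt PL_base[OF ab(1), of m] by (elim disjE) simp_all
  next
    case False
    have "W a \<noteq> W (b * t)" using False b W_base[OF ab(1)] by presburger
    then have "a + b * t \<noteq> 0 \<and> W (a + b * t) = min (W a) (W (b * t))"
      using val_L.P_add_neq[of a "b * t"] False ab t k_L by simp
    then have "a + b * t \<in> PL m \<longleftrightarrow> a \<in> PL m \<and> b * t \<in> PL m"
      using False ab t k_L by (auto simp: val_ge_def)
    then show ?thesis using bt PL_base[OF ab(1)] by simp
  qed
qed

text \<open>Convergence is checked on the coordinates with respect to \<open>1, t\<close>. The
  residue field does not grow, because \<open>b * t\<close> is in \<open>PL 1\<close> for integral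
  \<open>b\<close>; so perfectness is inherited.\<close>

lemma dyadic_field_L:
  assumes t: "t \<in> L" "t \<noteq> 0" "W t = 1"
  shows "dyadic_field L W"
proof
  have tk: "t \<notin> k" using uniformizer_not_base t by simp
  show "\<exists>p\<in>L. p \<noteq> 0 \<and> W p = 1" using t by blast
  show "0 < W 2" using W_base[of 2] w_2 by simp
  show "\<exists>c\<in>PL 0. x - c\<^sup>2 \<in> PL 1" if x: "x \<in> PL 0" for x
  proof -
    obtain a b where ab: "a \<in> k" "b \<in> k" "x = a + b * t"
      using generator_span[OF t(1) tk val_L.P_k[OF x]] by metis
    then have P: "a \<in> P 0" "b \<in> P 0" using PL_uniformizer[OF t ab(1,2), of 0] x by auto
    obtain c where c: "c \<in> P 0" "a - c\<^sup>2 \<in> P 1" using perfect[OF P(1)] by blast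
    have "x - c\<^sup>2 = (a - c\<^sup>2) + b * t" using ab by simp
    also have "\<dots> \<in> PL 1"
      using PL_uniformizer[OF t, of "a - c\<^sup>2" b 1] ab P c P_k by simp
    finally have "x - c\<^sup>2 \<in> PL 1" .
    moreover have "c \<in> PL 0" using c PL_base[OF P_k, of c 0 0] by simp
    ultimately show ?thesis by blast
  qed
  fix s :: "nat \<Rightarrow> 'a"
  assume s: "\<And>n. s n \<in> L" and cauchy: "\<And>M. \<exists>n0. \<forall>m\<ge>n0. \<forall>n\<ge>n0. s m - s n \<in> PL M"
  have "\<exists>a b. a \<in> k \<and> b \<in> k \<and> s n = a + b * t" for n
    using generator_span[OF t(1) tk s] by metis
  then obtain a b where ab: "\<And>n. a n \<in> k" "\<And>n. b n \<in> k" "\<And>n. s n = a n + b n * t" by metis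
  have "\<exists>n0. \<forall>m\<ge>n0. \<forall>n\<ge>n0. a m - a n \<in> P M \<and> b m - b n \<in> P M" for M
  proof -
    obtain n0 where n0: "\<And>m n. m \<ge> n0 \<Longrightarrow> n \<ge> n0 \<Longrightarrow> s m - s n \<in> PL (2 * M + 1)" using cauchy by metis
    have "a m - a n \<in> P M \<and> b m - b n \<in> P M" if "m \<ge> n0" "n \<ge> n0" for m n
    proof -
      have "s m - s n = (a m - a n) + (b m - b n) * t" by (simp add: ab algebra_simps)
      then have "(a m - a n) + (b m - b n) * t \<in> PL (2 * M + 1)" using n0[OF that] by metis
      moreover have "a m - a n \<in> k" "b m - b n \<in> k" using ab by simp_all
      ultimately have "a m - a n \<in> P ((2 * M + 1 + 1) div 2) \<and> b m - b n \<in> P ((2 * M + 1) div 2)"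
        using PL_uniformizer[OF t] by metis
      then show ?thesis by (auto elim!: P_mono)
    qed
    then show ?thesis by blast
  qed
  then have ca: "\<exists>n0. \<forall>m\<ge>n0. \<forall>n\<ge>n0. a m - a n \<in> P M"
    and cb: "\<exists>n0. \<forall>m\<ge>n0. \<forall>n\<ge>n0. b m - b n \<in> P M" for M by metis+
  obtain la where la: "la \<in> k" "\<And>M. \<exists>n0. \<forall>n\<ge>n0. a n - la \<in> P M"
    using complete[OF ab(1) ca] by metis
  obtain lb where lb: "lb \<in> k" "\<And>M. \<exists>n0. \<forall>n\<ge>n0. b n - lb \<in> P M"
    using complete[OF ab(2) cb] by metis
  have "\<exists>n0. \<forall>n\<ge>n0. s n - (la + lb * t) \<in> PL M" for M
  proof -
    obtain n1 where n1: "\<And>n. n \<ge> n1 \<Longrightarrow> a n - la \<in> P ((M + 1) div 2)" using la by metis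
    obtain n2 where n2: "\<And>n. n \<ge> n2 \<Longrightarrow> b n - lb \<in> P (M div 2)" using lb by metis
    have "s n - (la + lb * t) \<in> PL M" if n: "n \<ge> max n1 n2" for n
    proof -
      have "s n - (la + lb * t) = (a n - la) + (b n - lb) * t" by (simp add: ab algebra_simps)
      also have "\<dots> \<in> PL M"
        using n1[of n] n2[of n] n PL_uniformizer[OF t, of "a n - la" "b n - lb" M] ab la lb by simp
      finally show ?thesis .
    qed
    then show ?thesis by metis
  qed
  moreover have "la + lb * t \<in> L" using la lb t k_L by simp
  ultimately show "\<exists>l\<in>L. \<forall>M. \<exists>n0. \<forall>n\<ge>n0. s n - l \<in> PL M" by blast
qed

end

section \<open>The discriminant of a quadratic extension\<close>

text \<open>\<open>R\<close> remains the ring of integers of the bottom field \<open>K\<close> even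
  when the extension is \<open>M\<close> over \<open>k2\<close>, since the ideals in the theorem are
  formed from integral closures of \<open>R\<close>. The assumptions identify these closures with
  valuation rings.\<close>

locale integral_quadratic_ext = quadratic_ext +
  fixes R :: "'a set"
  assumes R_k: "int_ring R k = val_ge k w 0"
    and R_L: "int_ring R L = val_ge L (\<lambda>x. w (field_norm k L x)) 0"
begin

abbreviation D :: "'a \<Rightarrow> 'a" where "D x \<equiv> (Tr x)\<^sup>2 - 4 * N x"

lemma D_scale: "c \<in> k \<Longrightarrow> x \<in> L \<Longrightarrow> D (c * x) = c\<^sup>2 * D x"
  by (simp add: trace_scale norm_scale algebra_simps power2_eq_square)

lemma D_shift: "c \<in> k \<Longrightarrow> x \<in> L \<Longrightarrow> D (x + c) = D x"
  unfolding trace_shift norm_shift by (simp add: algebra_simps power2_eq_square)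

lemma trace_form:
  assumes x: "x \<in> L" and k: "a \<in> k" "b \<in> k" "c \<in> k" "d \<in> k"
  shows "Tr ((a + b * x) * (c + d * x)) = 2 * a * c + (a * d + b * c) * Tr x + b * d * ((Tr x)\<^sup>2 - 2 * N x)"
proof -
  have "(a + b * x) * (c + d * x) = a * c + (a * d + b * c) * x + b * d * x\<^sup>2"
    by (simp add: algebra_simps power2_eq_square)
  also have "x\<^sup>2 = Tr x * x - N x" using monic_quadratic_solve[OF charpoly[OF x]] .
  finally have "(a + b * x) * (c + d * x)
      = (a * d + b * c + b * d * Tr x) * x + (a * c - b * d * N x)"
    by (simp add: algebra_simps)
  then have "Tr ((a + b * x) * (c + d * x))
      = (a * d + b * c + b * d * Tr x) * Tr x + 2 * (a * c - b * d * N x)"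
    using x k k_L by (simp add: trace_shift trace_scale)
  then show ?thesis by (simp add: algebra_simps power2_eq_square)
qed

text \<open>The assumption \<open>gen\<close> makes \<open>1, x\<close> an integral basis. Any other
  basis of integers has as discriminant \<open>D x\<close> times the square of an integral
  transition determinant.\<close>

lemma disc_ideal_generator:
  assumes x: "x \<in> L" "x \<notin> k" "N x \<in> P 0"
    and gen: "\<And>a b. a \<in> k \<Longrightarrow> b \<in> k \<Longrightarrow> a + b * x \<in> PL 0 \<Longrightarrow> a \<in> P 0 \<and> b \<in> P 0"
  shows "disc_ideal R k L = P (w (D x))"
  unfolding disc_ideal_def R_k
proof (rule ideal_gen_eq_P[where s = "D x"])
  have T: "Tr x \<in> P 0" using trace_P[OF x(1,3)] by simp
  have DP: "D x \<in> P 0"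
    using P_power[OF T, of 2] P_mult_0[OF P_numeral x(3)] by (intro P_diff) auto
  show nz: "D x \<noteq> 0" using discr_nonzero x by simp
  show "0 \<le> w (D x)" using DP nz by (simp add: val_ge_def)
  let ?S = "{det (mat n n (\<lambda>(i, j). Tr (b i * b j))) |n b.
    is_basis k L n b \<and> (\<forall>i<n. b i \<in> int_ring R L)}"
  have det: "det (mat 2 2 (\<lambda>(i, j). Tr (b i * b j))) = Tr (b 0 * b 0) * Tr (b 1 * b 1) - Tr (b 0 * b 1) * Tr (b 1 * b 0)"
    for b :: "nat \<Rightarrow> 'a"
    by (subst det_2) auto
  show "D x \<in> ?S"
  proof -
    define b where "b = (\<lambda>i::nat. if i = 0 then 1 else x)"
    have "Tr (x * x) = (Tr x)\<^sup>2 - 2 * N x" using trace_form[OF x(1), of 0 1 0 1] by simp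
    then have "det (mat 2 2 (\<lambda>(i, j). Tr (b i * b j))) = D x"
      unfolding det by (simp add: b_def trace_base power2_eq_square)
    moreover have "is_basis k L 2 b" using generator_basis x by (simp add: b_def)
    moreover have "\<forall>i<2. b i \<in> int_ring R L"
      using x PL_iff_norm val_L.P_1 unfolding R_L by (simp add: b_def)
    ultimately show ?thesis by (intro CollectI exI[of _ 2] exI[of _ b]) simp
  qed
  show "?S \<subseteq> P (w (D x))"
  proof clarify
    fix n b assume b: "is_basis k L n b" and int: "\<forall>i<n. b i \<in> int_ring R L"
    have n: "n = 2" using is_basis_dim_unique[OF sub_k b generator_basis[OF x(1,2)]] .
    have "\<exists>a c. a \<in> P 0 \<and> c \<in> P 0 \<and> b i = a + c * x" if "i < 2" for i
    proof -
      have bi: "b i \<in> PL 0" using int that unfolding n R_L by simp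
      obtain a c where ac: "a \<in> k" "c \<in> k" "b i = a + c * x"
        using generator_span[OF x(1,2) val_L.P_k[OF bi]] by metis
      then show ?thesis using gen[OF ac(1,2)] bi by metis
    qed
    from this[of 0] this[of 1] obtain a c a' c' where
      P: "a \<in> P 0" "c \<in> P 0" "a' \<in> P 0" "c' \<in> P 0" and b: "b 0 = a + c * x" "b 1 = a' + c' * x"
      by auto
    have "det (mat n n (\<lambda>(i, j). Tr (b i * b j))) = (a * c' - a' * c)\<^sup>2 * D x"
      unfolding n det b using P P_k x by (simp add: trace_form) (simp add: algebra_simps power2_eq_square)
    moreover have "(a * c' - a' * c)\<^sup>2 \<in> P 0"
      using P_power[of "a * c' - a' * c" 0 2] P_diff[OF P_mult_0 P_mult_0] P by simp
    ultimately show "det (mat n n (\<lambda>(i, j). Tr (b i * b j))) \<in> P (w (D x))"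
      using P_mult_0[of _ "D x" "w (D x)"] P_iff[of "D x"] nz x by simp
  qed
qed simp

text \<open>A scalar of valuation \<open>- j\<close> turns \<open>x\<close> into a uniformizer
  \<open>t\<close>, for which \<open>1, t\<close> is an integral basis; the discriminant changes by
  the square of that scalar.\<close>

lemma disc_ideal_odd:
  assumes x: "x \<in> L" "x \<noteq> 0" "W x = 2 * j + 1"
  shows "disc_ideal R k L = P (w (D x) - 2 * j)"
proof -
  obtain c where c: "c \<in> k" "c \<noteq> 0" "w c = - j" "W (c * x) = W x + 2 * - j"
    using scale_W[OF x(1,2)] by metis
  define t where "t = c * x"
  have t: "t \<in> L" "t \<noteq> 0" "W t = 1" using c x k_L by (auto simp: t_def)
  have tk: "t \<notin> k" using uniformizer_not_base t by simp
  have "disc_ideal R k L = P (w (D t))"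
    using PL_uniformizer[OF t, of _ _ 0] t tk
    by (intro disc_ideal_generator) (auto simp: P_iff norm_eq_0_iff)
  moreover have "x \<notin> k" using uniformizer_not_base x by simp
  then have "w (D t) = w (D x) - 2 * j"
    using c x discr_nonzero[of x] unfolding t_def by (simp add: D_scale w_mult w_power)
  ultimately show ?thesis by simp
qed

lemma disc_ideal_unit:
  assumes x: "x \<in> L" "x \<notin> k" "N x \<in> P (2 * j)" "w (D x) = 2 * j"
  shows "disc_ideal R k L = P 0"
proof -
  have nz: "x \<noteq> 0" using x by auto
  obtain c where c: "c \<in> k" "c \<noteq> 0" "w c = - j" "W (c * x) = W x + 2 * - j"
    using scale_W[OF x(1) nz] by metis
  define t where "t = c * x"
  have t: "t \<in> L" "t \<noteq> 0" using c x nz k_L by (auto simp: t_def)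
  have tk: "t \<notin> k"
  proof
    assume "t \<in> k"
    then have "t / c \<in> k" using c by simp
    then show False using x c by (simp add: t_def)
  qed
  have Nt: "N t \<in> P 0"
    using x c nz t by (simp add: P_iff norm_eq_0_iff t_def)
  have D0: "w (D t) = 0" "D t \<noteq> 0"
    using c x discr_nonzero[of x] unfolding t_def by (auto simp: D_scale w_mult w_power)
  have "disc_ideal R k L = P (w (D t))"
  proof (rule disc_ideal_generator[OF t(1) tk Nt])
    fix a b assume ab: "a \<in> k" "b \<in> k" "a + b * t \<in> PL 0"
    define y where "y = b * t + a"
    have y: "y \<in> L" "y \<in> PL 0" using ab t k_L by (auto simp: y_def add.commute)
    then have N: "N y \<in> P 0" using PL_iff_norm by simp
    have T: "Tr y \<in> P 0" using trace_P[OF y(1) N] by simp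
    \<comment> \<open>An integral element has integral discriminant, here \<open>b^2\<close> times
      the unit \<open>D t\<close>; this forces \<open>b\<close>, and then \<open>a\<close>, to be
      integral.\<close>
    have "D y \<in> P 0"
      using P_power[OF T, of 2] P_mult_0[OF P_numeral N] by (intro P_diff) auto
    moreover have "D y = b\<^sup>2 * D t" using ab t k_L unfolding y_def by (simp only: D_shift D_scale val_L.k_intros)
    ultimately have "b = 0 \<or> 0 \<le> 2 * w b"
      using ab D0 t by (cases "b = 0") (auto simp: val_ge_def w_mult w_power)
    then have b: "b \<in> P 0" using ab by (auto simp: val_ge_def)
    then have "b * t \<in> PL 0"
      using PL_base[OF ab(2), of 0] PL_iff_norm[OF t(1), of 0] Nt by (intro val_L.P_mult_0) simp_all
    from val_L.P_diff[OF ab(3) this] have "a \<in> PL 0" by simp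
    then show "a \<in> P 0 \<and> b \<in> P 0" using b PL_base[OF ab(1), of 0] by simp
  qed
  then show ?thesis using D0 by simp
qed

text \<open>If no translate of \<open>x\<close> has larger valuation, the reduction of its (scaled) characteristic
  polynomial is irreducible, hence separable because the residue field is perfect.\<close>

lemma discr_even_max:
  assumes x: "x \<in> L" "x \<notin> k" "W x = 2 * j"
    and max: "\<And>c. c \<in> k \<Longrightarrow> W (x + c) \<le> 2 * j"
  shows "w (D x) = 2 * j"
proof -
  have nz: "x \<noteq> 0" using x by auto
  have N: "N x \<in> P (2 * j)" using x nz by (simp add: P_iff norm_eq_0_iff)
  obtain c where c: "c \<in> k" "c \<noteq> 0" "w c = - j" "W (c * x) = W x + 2 * - j"
    using scale_W[OF x(1) nz] by metis
  have "Tr x \<notin> P (j + 1)"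
  proof
    assume T: "Tr x \<in> P (j + 1)"
    define y where "y = c * x"
    have y: "y \<in> L" using c x k_L by (simp add: y_def)
    have "c \<in> P (- j)" using c by (simp add: P_iff)
    from P_mult[OF this T] have Ty: "Tr y \<in> P 1" using c x by (simp add: y_def trace_scale)
    have Ny: "N y \<in> P 0" using c x nz y by (simp add: P_iff norm_eq_0_iff y_def)
    \<comment> \<open>With trace in \<open>P 1\<close> the characteristic polynomial of
      \<open>y\<close> reduces to the square \<open>(z + d)^2\<close> in characteristic 2.
      Translating by \<open>d\<close> then raises the valuation, against maximality.\<close>
    obtain d where d: "d \<in> P 0" "N y - d\<^sup>2 \<in> P 1" using perfect[OF Ny] by blast
    have d2: "d\<^sup>2 \<in> P 0" using P_power[OF d(1), of 2] by simp
    have "(N y - d\<^sup>2) + d * Tr y + d\<^sup>2 * 2 \<in> P 1"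
      using d(2) P_mult_0[OF d(1) Ty] P_mult_0[OF d2 P_numeral_2] by (intro P_add)
    also have "(N y - d\<^sup>2) + d * Tr y + d\<^sup>2 * 2 = N (y + d)"
      using norm_shift[OF P_k[OF d(1)] y] by simp
    finally have "N (y + d) \<in> P 1" .
    moreover have dk: "d / c \<in> k" using d P_k c by simp
    have "y + d = c * (x + d / c)" using c by (simp add: y_def algebra_simps)
    then have "N (y + d) = c\<^sup>2 * N (x + d / c)" using norm_scale[of c "x + d / c"] c x dk k_L by simp
    moreover have "x + d / c \<noteq> 0"
    proof
      assume "x + d / c = 0"
      then have "x = - (d / c)" by (simp add: eq_neg_iff_add_eq_0)
      then show False using x dk by (metis subfield_uminus sub_k)
    qed
    ultimately have "W (x + d / c) \<ge> 2 * j + 1"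
      using c x dk k_L by (simp add: val_ge_def w_mult w_power norm_eq_0_iff)
    then show False using max[OF dk] by simp
  qed
  moreover have "Tr x \<in> P j" using trace_P[OF x(1) N] by simp
  ultimately have T: "Tr x \<noteq> 0" "w (Tr x) = j" by (auto simp: val_ge_def)
  have "2 * 2 * - N x \<in> P (1 + 2 * j)"
    by (intro P_mult P_mult_0 P_numeral P_numeral_2 P_uminus N)
  then have "- (4 * N x) \<in> P (2 * j + 1)" by (simp add: add.commute)
  then show ?thesis using w_add_eq[of "(Tr x)\<^sup>2" "- (4 * N x)"] T x by (simp add: w_power)
qed

text \<open>As \<open>D\<close> is translation invariant, this bounds the valuations of all
  translates of \<open>x\<close> at once, which is what makes a maximal one exist.\<close>

lemma W_le_discr:
  assumes x: "x \<in> L" "x \<notin> k"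
  shows "2 * (W x div 2) \<le> w (D x)"
proof -
  have nz: "x \<noteq> 0" using x by auto
  have N: "N x \<in> P (W x)" using x nz by (simp add: P_iff norm_eq_0_iff)
  have T: "Tr x \<in> P (W x div 2)" using trace_P[OF x(1) N] by simp
  have "D x \<in> P (2 * (W x div 2))"
    using P_power[OF T, of 2] P_mult_0[OF P_numeral P_mono[OF N, of "2 * (W x div 2)"]] by (intro P_diff) auto
  then show ?thesis using discr_nonzero[OF x] by (simp add: val_ge_def)
qed

lemma disc_ideal_max:
  assumes x: "x \<in> L" "x \<notin> k"
  obtains c where "c \<in> k" "\<And>c'. c' \<in> k \<Longrightarrow> W (x + c') \<le> W (x + c)"
    "disc_ideal R k L = P (w (D x) - 2 * (W (x + c) div 2))"
    "even (W (x + c)) \<Longrightarrow> W (x + c) = w (D x)"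
proof -
  have xc: "x + c \<in> L" "x + c \<notin> k" if "c \<in> k" for c
  proof -
    show "x + c \<in> L" using x that k_L by simp
    show "x + c \<notin> k" using x that subfield_diff[OF sub_k, of "x + c" c] by auto
  qed
  have bound: "2 * (W (x + c) div 2) \<le> w (D x)" if "c \<in> k" for c
    using W_le_discr[OF xc[OF that]] D_shift[OF that x(1)] by simp
  \<comment> \<open>Maximising \<open>W (x + c)\<close> as minimising a natural number. By
    \<open>bound\<close>, \<open>W (x + c)\<close> is at most \<open>w (D x) + 1\<close>, so
    \<open>nat\<close> truncates nothing.\<close>
  obtain c where c: "c \<in> k"
    and least: "\<And>c'. c' \<in> k \<Longrightarrow> nat (w (D x) + 1 - W (x + c)) \<le> nat (w (D x) + 1 - W (x + c'))"
    using ex_has_least_nat[of "\<lambda>c. c \<in> k" 0 "\<lambda>c. nat (w (D x) + 1 - W (x + c))"] by auto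
  have max: "W (x + c') \<le> W (x + c)" if "c' \<in> k" for c'
    using least[OF that] bound[OF that] bound[OF c] by linarith
  show ?thesis
  proof (cases "even (W (x + c))")
    case True
    define j where "j = W (x + c) div 2"
    have j: "W (x + c) = 2 * j" using True by (simp add: j_def)
    have "w (D (x + c)) = 2 * j"
    proof (rule discr_even_max[OF xc[OF c] j])
      fix d assume d: "d \<in> k"
      show "W (x + c + d) \<le> 2 * j" using max[of "c + d"] c d j by (simp add: add.assoc)
    qed
    then have "disc_ideal R k L = P 0" "w (D x) = 2 * j"
      using disc_ideal_unit[OF xc[OF c], of j] j xc[OF c] D_shift[OF c x(1)]
      by (auto simp: val_ge_def norm_eq_0_iff)
    then show ?thesis using that[OF c max] j by simp
  next
    case False
    define j where "j = W (x + c) div 2"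
    have j: "W (x + c) = 2 * j + 1" using False by (simp add: j_def)
    have "x + c \<noteq> 0" using xc(2)[OF c] by auto
    then have "disc_ideal R k L = P (w (D x) - 2 * j)"
      using disc_ideal_odd[OF xc(1)[OF c] _ j] D_shift[OF c x(1)] by simp
    then show ?thesis using that[OF c max] j by simp
  qed
qed

text \<open>Without an element of valuation 1, scaling shows that all valuations are even. Then the
  \<open>e\<close>-th power of the prime ideal lies in \<open>PL (2 e)\<close>, while a uniformizer
  of \<open>k\<close> has valuation only 2 and \<open>e\<close> is at least 2.\<close>

lemma ramified_uniformizer:
  assumes "is_ramified R k L"
  shows "\<exists>t\<in>L. t \<noteq> 0 \<and> W t = 1"
proof (rule ccontr)
  assume no: "\<not> (\<exists>t\<in>L. t \<noteq> 0 \<and> W t = 1)"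
  have ev: "even (W x)" if x: "x \<in> L" "x \<noteq> 0" for x
  proof (rule ccontr)
    assume "odd (W x)"
    obtain c where c: "c \<in> k" "c \<noteq> 0" "W (c * x) = W x + 2 * - (W x div 2)"
      using scale_W[OF x] by metis
    then have "W (c * x) = 1" using \<open>odd (W x)\<close> by presburger
    then show False using no x c k_L by (metis mult_eq_0_iff subfield_mult sub_L)
  qed
  obtain e where e: "2 \<le> e" "ideal_gen (int_ring R L) (prime_ideal R k) = prime_pow R L e"
    using assms unfolding is_ramified_def by blast
  have sub: "ideal_pow (PL 0) (PL 1) n \<subseteq> PL (2 * int n)" for n
  proof (induction n)
    case (Suc n)
    have "x * y \<in> PL (2 * int (Suc n))" if x: "x \<in> PL 1" and y: "y \<in> ideal_pow (PL 0) (PL 1) n" for x y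
    proof -
      have "x = 0 \<or> W x \<noteq> 1" using ev[of x] val_L.P_k[OF x] by (cases "W x = 1") auto
      then have "x \<in> PL 2" using x by (auto simp: val_ge_def)
      then show ?thesis using val_L.P_mult[of x 2 y "2 * int n"] y Suc by auto
    qed
    then have "{x * y |x y. x \<in> PL 1 \<and> y \<in> ideal_pow (PL 0) (PL 1) n} \<subseteq> PL (2 * int (Suc n))" by blast
    moreover have "is_ideal (PL 0) (PL (2 * int (Suc n)))" by (rule val_L.is_ideal_P) simp
    ultimately show ?case unfolding ideal_pow.simps ideal_gen_def by (intro Inter_lower) simp
  qed simp
  obtain p where p: "p \<in> k" "p \<noteq> 0" "w p = 1" using surj by blast
  have "p \<in> prime_ideal R k" using prime_ideal_eq_P[OF R_k] p by (simp add: P_iff)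
  then have "p \<in> ideal_gen (int_ring R L) (prime_ideal R k)" unfolding ideal_gen_def by blast
  also have "\<dots> = ideal_pow (PL 0) (PL 1) e"
    unfolding e(2) val_L.prime_ideal_eq_P[OF R_L] unfolding R_L ..
  finally have "p \<in> PL (2 * int e)" using sub by blast
  then show False using p e(1) W_base[OF p(1,2)] by (simp add: val_ge_def)
qed

end

section \<open>The residue field of a dyadic completion is perfect\<close>

text \<open>Gaussian elimination: a pivot row \<open>p\<close> clears the last coordinate of the
  others, and the induction continues with one row and one coordinate fewer.\<close>

lemma exists_linear_relation:
  fixes k :: "'a::field_char_0 set"
  assumes k: "is_subfield k" and J: "finite J" "n < card J"
    and A: "\<And>j i. j \<in> J \<Longrightarrow> i < n \<Longrightarrow> A j i \<in> k"
  shows "\<exists>q. (\<forall>j\<in>J. q j \<in> k) \<and> (\<exists>j\<in>J. q j \<noteq> 0) \<and> (\<forall>i<n. (\<Sum>j\<in>J. q j * A j i) = 0)"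
  using J A
proof (induction n arbitrary: J A)
  case 0
  then obtain j where "j \<in> J" by fastforce
  then show ?case using subfield_1[OF k] by (intro exI[of _ "\<lambda>_. 1"]) auto
next
  case (Suc n)
  show ?case
  proof (cases "\<forall>j\<in>J. A j n = 0")
    case True
    obtain q where "\<forall>j\<in>J. q j \<in> k" "\<exists>j\<in>J. q j \<noteq> 0" "\<forall>i<n. (\<Sum>j\<in>J. q j * A j i) = 0"
      using Suc.IH[of J A] Suc.prems by auto
    then show ?thesis using True by (intro exI[of _ q]) (auto simp: less_Suc_eq)
  next
    case False
    then obtain p where p: "p \<in> J" "A p n \<noteq> 0" by auto
    define J' where "J' = J - {p}"
    define A' where "A' = (\<lambda>j i. A j i - A j n / A p n * A p i)"
    have J': "finite J'" "n < card J'" using Suc.prems p by (auto simp: J'_def)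
    have "A' j i \<in> k" if "j \<in> J'" "i < n" for j i
      using Suc.prems(3) p that unfolding A'_def J'_def
      by (auto intro!: subfield_diff[OF k] subfield_mult[OF k] subfield_divide[OF k])
    from Suc.IH[where A = A', OF J' this] obtain q where q: "\<forall>j\<in>J'. q j \<in> k" "\<exists>j\<in>J'. q j \<noteq> 0"
      "\<And>i. i < n \<Longrightarrow> (\<Sum>j\<in>J'. q j * A' j i) = 0" by auto
    have q': "(\<Sum>j\<in>J'. q j * A' j i) = 0" if "i < Suc n" for i
    proof (cases "i = n")
      case True
      then show ?thesis using p by (simp add: A'_def)
    qed (use q that in auto)
    \<comment> \<open>The pivot coefficient that turns a relation between the reduced rows into one
      between the original rows.\<close>
    define c where "c = - (\<Sum>j\<in>J'. q j * (A j n / A p n))"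
    have c: "c \<in> k" unfolding c_def
      using q Suc.prems(3) p unfolding J'_def
      by (auto intro!: subfield_uminus[OF k] subfield_sum[OF k] subfield_mult[OF k] subfield_divide[OF k])
    show ?thesis
    proof (intro exI[of _ "q(p := c)"] conjI allI impI)
      show "\<forall>j\<in>J. (q(p := c)) j \<in> k" using q c by (auto simp: J'_def)
      show "\<exists>j\<in>J. (q(p := c)) j \<noteq> 0" using q(2) by (auto simp: J'_def)
      fix i assume i: "i < Suc n"
      have "(\<Sum>j\<in>J. (q(p := c)) j * A j i) = c * A p i + (\<Sum>j\<in>J'. (q(p := c)) j * A j i)"
        using p Suc.prems by (subst sum.remove[of _ p]) (auto simp: J'_def)
      also have "(\<Sum>j\<in>J'. (q(p := c)) j * A j i) = (\<Sum>j\<in>J'. q j * A j i)"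
        by (intro sum.cong) (auto simp: J'_def)
      also have "c * A p i + (\<Sum>j\<in>J'. q j * A j i) = (\<Sum>j\<in>J'. q j * A' j i)"
        by (simp add: c_def A'_def algebra_simps sum_subtractf sum_distrib_left sum_distrib_right)
      finally show "(\<Sum>j\<in>J. (q(p := c)) j * A j i) = 0" using q'[OF i] by simp
    qed
  qed
qed

lemma is_basis_relation:
  fixes k :: "'a::field_char_0 set"
  assumes k: "is_subfield k" and b: "is_basis k L n b" and J: "finite J" "n < card J"
    and u: "\<And>j. j \<in> J \<Longrightarrow> u j \<in> L"
  shows "\<exists>q. (\<forall>j\<in>J. q j \<in> k) \<and> (\<exists>j\<in>J. q j \<noteq> 0) \<and> (\<Sum>j\<in>J. q j * u j) = 0"
proof -
  have "\<forall>j\<in>J. \<exists>c. (\<forall>i<n. c i \<in> k) \<and> u j = (\<Sum>i<n. c i * b i)"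
    using is_basis_span[OF b u] by simp
  then obtain A where A: "\<forall>j\<in>J. (\<forall>i<n. A j i \<in> k) \<and> u j = (\<Sum>i<n. A j i * b i)"
    by (rule bchoice[THEN exE])
  then have "\<And>j i. j \<in> J \<Longrightarrow> i < n \<Longrightarrow> A j i \<in> k" by simp
  from exists_linear_relation[where A = A, OF k J this] obtain q where q: "\<forall>j\<in>J. q j \<in> k" "\<exists>j\<in>J. q j \<noteq> 0"
    "\<forall>i<n. (\<Sum>j\<in>J. q j * A j i) = 0" by auto
  have "(\<Sum>j\<in>J. q j * u j) = (\<Sum>j\<in>J. \<Sum>i<n. q j * A j i * b i)"
    using A by (intro sum.cong) (auto simp: sum_distrib_left mult.assoc)
  also have "\<dots> = (\<Sum>i<n. (\<Sum>j\<in>J. q j * A j i) * b i)"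
    by (subst sum.swap) (simp add: sum_distrib_right)
  also have "\<dots> = 0" using q(3) by simp
  finally show ?thesis using q by (intro exI[of _ q]) simp
qed

lemma is_subfield_Rats: "is_subfield (\<rat> :: 'a::field_char_0 set)"
  by (auto simp: is_subfield_def)

context valued_subfield
begin

lemma one_not_in_P_1: "1 \<notin> P 1" by (simp add: val_ge_def)

lemma even_in_P_1:
  assumes "2 \<in> P 1" "even m" shows "of_int m \<in> P 1"
proof -
  obtain l where "m = 2 * l" using assms by auto
  then show ?thesis using P_mult_0[OF P_of_int[of l] assms(1)] by (simp add: mult.commute)
qed

text \<open>An integral rational has odd denominator in lowest terms, so its residue is decided by
  the parity of the numerator: the residue is 0 or 1.\<close>

lemma rational_residue:
  assumes two: "2 \<in> P 1" and r: "r \<in> \<rat>" "r \<in> P 0"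
  shows "r \<in> P 1 \<or> r - 1 \<in> P 1"
proof -
  have odd: "of_int m - 1 \<in> P 1" if "odd m" for m
    using even_in_P_1[OF two, of "m - 1"] that by simp
  obtain q where q: "r = of_rat q" using r by (auto elim: Rats_cases)
  obtain a b where ab: "quotient_of q = (a, b)" by fastforce
  have b0: "b > 0" and cop: "coprime a b" and "q = of_int a / of_int b"
    using quotient_of_denom_pos[OF ab] quotient_of_coprime[OF ab] quotient_of_div[OF ab] by auto
  then have eq: "r * of_int b = of_int a" by (simp add: q of_rat_divide)
  have "odd b"
  proof
    assume b: "even b"
    then have "odd a" using cop by (meson coprime_common_divisor odd_one)
    have "of_int a \<in> P 1"
      using P_mult_0[OF r(2) even_in_P_1[OF two b]] by (simp add: eq)
    from P_diff[OF this odd[OF \<open>odd a\<close>]] show False using one_not_in_P_1 by simp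
  qed
  have "of_int b \<notin> P 1"
  proof
    assume "of_int b \<in> P 1"
    from P_diff[OF this odd[OF \<open>odd b\<close>]] show False using one_not_in_P_1 by simp
  qed
  then have wb: "w (of_int b) = 0" using P_of_int[of b] by (auto simp: val_ge_def)
  have div: "z \<in> P 1" if "z * of_int b \<in> P 1" for z
    using P_divide[OF that, of "of_int b"] b0 wb by simp
  show ?thesis
  proof (cases "even a")
    case True
    then show ?thesis using div even_in_P_1[OF two True] eq by simp
  next
    case False
    have "(r - 1) * of_int b = of_int (a - b)" by (simp add: left_diff_distrib eq)
    then show ?thesis using div even_in_P_1[OF two, of "a - b"] False \<open>odd b\<close> by simp
  qed
qed

lemma frobenius_sum:
  assumes two: "2 \<in> P 1" and "finite S" "\<And>i. i \<in> S \<Longrightarrow> f i \<in> P 0"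
  shows "(\<Sum>i\<in>S. f i)\<^sup>2 - (\<Sum>i\<in>S. (f i)\<^sup>2) \<in> P 1"
  using assms(2,3)
proof (induction S rule: finite_induct)
  case (insert i S)
  have "sum f S \<in> P 0" using insert by (intro P_sum) auto
  then have "2 * (f i * sum f S) \<in> P 1"
    using insert P_mult[OF two P_mult_0, of "f i" "sum f S" 0] by simp
  from P_add[OF this insert.IH]
  have "2 * (f i * sum f S) + ((sum f S)\<^sup>2 - (\<Sum>i\<in>S. (f i)\<^sup>2)) \<in> P 1" using insert by simp
  also have "2 * (f i * sum f S) + ((sum f S)\<^sup>2 - (\<Sum>i\<in>S. (f i)\<^sup>2))
      = (f i + sum f S)\<^sup>2 - ((f i)\<^sup>2 + (\<Sum>i\<in>S. (f i)\<^sup>2))"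
    by (simp add: power2_eq_square algebra_simps)
  finally show ?case using insert by simp
qed simp

text \<open>An additive polynomial with coefficients in the prime field is a Frobenius twist of
  one with nonzero linear coefficient; its roots are squares.\<close>

lemma square_residue_if_additive_relation:
  assumes two: "2 \<in> P 1" and x: "x \<in> P 0"
    and r: "\<And>j. r j \<in> P 1 \<or> r j - 1 \<in> P 1"
    and sum: "(\<Sum>j\<le>m. r j * x ^ (2 ^ j)) \<in> P 1" and nz: "\<exists>j\<le>m. r j \<notin> P 1"
  shows "\<exists>c\<in>P 0. x - c\<^sup>2 \<in> P 1"
  using r sum nz
proof (induction m arbitrary: r)
  case 0
  then have "r 0 - 1 \<in> P 1" "r 0 * x \<in> P 1" by auto
  from P_diff[OF this(2) P_mult_0[OF x this(1)]] have "x \<in> P 1" by (simp add: algebra_simps)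
  then show ?case by (intro bexI[of _ 0]) auto
next
  case (Suc m)
  have r0: "r j \<in> P 0" for j
  proof (cases "r j \<in> P 1")
    case True
    then show ?thesis by (rule P_mono) simp
  next
    case False
    then have "r j - 1 \<in> P 0" using Suc.prems(1)[of j] P_mono[of "r j - 1" 1 0] by simp
    from P_add[OF this P_1] show ?thesis by simp
  qed
  have xp: "x ^ n \<in> P 0" for n using P_power[OF x, of n] by simp
  \<comment> \<open>The relation without its linear term is \<open>g^2\<close> modulo
    \<open>P 1\<close>: squaring is additive there and fixes the coefficients, whose residues are 0
    or 1.\<close>
  define g where "g = (\<Sum>j\<le>m. r (Suc j) * x ^ (2 ^ j))"
  have g0: "g \<in> P 0" unfolding g_def using r0 xp by (intro P_sum P_mult_0)
  have frob: "(r j * u)\<^sup>2 - r j * u\<^sup>2 \<in> P 1" if u: "u \<in> P 0" for j u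
  proof -
    have "r j * (r j - 1) \<in> P 1"
      using Suc.prems(1)[of j] P_mult_0[OF r0[of j], of "r j - 1" 1]
        P_mult[of "r j" 1 "r j - 1" 0] P_diff[OF r0[of j] P_1] by auto
    moreover have "u\<^sup>2 \<in> P 0" using P_power[OF u, of 2] by simp
    ultimately have "u\<^sup>2 * (r j * (r j - 1)) \<in> P 1" by (rule P_mult_0[rotated])
    also have "u\<^sup>2 * (r j * (r j - 1)) = (r j * u)\<^sup>2 - r j * u\<^sup>2"
      by (simp add: power2_eq_square algebra_simps)
    finally show ?thesis .
  qed
  have "(\<Sum>j\<le>m. (r (Suc j) * x ^ (2 ^ j))\<^sup>2 - r (Suc j) * (x ^ (2 ^ j))\<^sup>2) \<in> P 1"
    by (intro P_sum frob xp)
  moreover have "g\<^sup>2 - (\<Sum>j\<le>m. (r (Suc j) * x ^ (2 ^ j))\<^sup>2) \<in> P 1"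
    unfolding g_def using r0 xp by (intro frobenius_sum two P_mult_0) auto
  ultimately have "g\<^sup>2 - (\<Sum>j\<le>m. r (Suc j) * (x ^ (2 ^ j))\<^sup>2) \<in> P 1"
    using P_add by (fastforce simp: sum_subtractf)
  moreover have "(\<Sum>j\<le>Suc m. r j * x ^ (2 ^ j)) = r 0 * x + (\<Sum>j\<le>m. r (Suc j) * (x ^ (2 ^ j))\<^sup>2)"
    by (simp add: sum.atMost_Suc_shift power_mult[symmetric] mult.commute del: sum.atMost_Suc)
  \<comment> \<open>If \<open>r 0\<close> has residue 0, then \<open>g\<close> itself vanishes
    modulo \<open>P 1\<close>, a shorter relation. Otherwise \<open>x\<close> is congruent to
    \<open>- g^2\<close>, hence to \<open>g^2\<close> in characteristic 2.\<close>
  ultimately have main: "r 0 * x + g\<^sup>2 \<in> P 1"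
    using P_add[OF Suc.prems(2), of "g\<^sup>2 - (\<Sum>j\<le>m. r (Suc j) * (x ^ (2 ^ j))\<^sup>2)"] by simp
  show ?case
  proof (cases "r 0 \<in> P 1")
    case True
    have "g\<^sup>2 \<in> P 1" using P_diff[OF main P_mult_0[OF x True]] by (simp add: mult.commute)
    then have "g \<in> P 1" using P_square_iff[OF P_k[OF g0], of 1] by simp
    moreover have "\<exists>j\<le>m. r (Suc j) \<notin> P 1" using Suc.prems(3) True
      by (metis Suc_le_mono not0_implies_Suc)
    ultimately show ?thesis using Suc.IH[of "\<lambda>j. r (Suc j)"] Suc.prems(1) unfolding g_def by simp
  next
    case False
    then have "r 0 - 1 \<in> P 1" using Suc.prems(1) by auto
    from P_diff[OF main P_mult_0[OF x this]] have "x + g\<^sup>2 \<in> P 1" by (simp add: algebra_simps)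
    moreover have "g\<^sup>2 * 2 \<in> P 1" using P_power[OF g0, of 2] two by (intro P_mult_0) auto
    ultimately have "x + g\<^sup>2 - g\<^sup>2 * 2 \<in> P 1" by (rule P_diff)
    then show ?thesis using g0 by (intro bexI[of _ g]) auto
  qed
qed

text \<open>The \<open>n + 1\<close> elements \<open>x^(2^j)\<close>, \<open>j \<le> n\<close>, are
  dependent over the rationals. Dividing by a coefficient of least valuation makes all coefficients
  integral and one of them 1, so the relation survives in the residue field.\<close>

lemma perfect_if_number_field:
  assumes two: "2 \<in> P 1" and F: "extension_of_degree \<rat> F n" "F \<subseteq> k" and x: "x \<in> F" "x \<in> P 0"
  shows "\<exists>c\<in>P 0. x - c\<^sup>2 \<in> P 1"
proof -
  obtain b where b: "is_basis \<rat> F n b" and F': "is_subfield F"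
    using F by (auto simp: extension_of_degree_def)
  have "\<exists>q. (\<forall>j\<in>{..n}. q j \<in> \<rat>) \<and> (\<exists>j\<in>{..n}. q j \<noteq> 0) \<and> (\<Sum>j\<in>{..n}. q j * x ^ (2 ^ j)) = 0"
    using x(1) F' by (intro is_basis_relation[OF is_subfield_Rats b] subfield_power) auto
  then obtain q where q: "\<And>j. j \<le> n \<Longrightarrow> q j \<in> \<rat>" "\<exists>j\<le>n. q j \<noteq> 0"
    "(\<Sum>j\<le>n. q j * x ^ (2 ^ j)) = 0" by auto
  define J where "J = {j. j \<le> n \<and> q j \<noteq> 0}"
  have "finite J" "J \<noteq> {}" using q(2) by (auto simp: J_def)
  then obtain p where p: "p \<in> J" "\<And>j. j \<in> J \<Longrightarrow> w (q p) \<le> w (q j)"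
    using arg_min_if_finite[of J "\<lambda>j. w (q j)"] by (metis linorder_not_le)
  then have p': "p \<le> n" "q p \<noteq> 0" by (auto simp: J_def)
  define r where "r = (\<lambda>j. if j \<le> n then q j / q p else 0)"
  have qk: "q j \<in> k" if "j \<le> n" for j
    using q(1)[OF that] by (auto elim!: Rats_cases)
  have r: "r j \<in> \<rat>" for j using q(1) p' by (simp add: r_def)
  have "r j \<in> P 0" for j
    using p(2)[of j] p' qk by (cases "q j = 0") (auto simp: r_def J_def val_ge_def w_divide)
  then have res: "r j \<in> P 1 \<or> r j - 1 \<in> P 1" for j using rational_residue[OF two r] by simp
  have "(\<Sum>j\<le>n. r j * x ^ (2 ^ j)) = (\<Sum>j\<le>n. q j * x ^ (2 ^ j)) / q p"
    unfolding sum_divide_distrib by (intro sum.cong) (auto simp: r_def)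
  then have "(\<Sum>j\<le>n. r j * x ^ (2 ^ j)) \<in> P 1" using q(3) by simp
  moreover have "r p \<notin> P 1" using p' one_not_in_P_1 by (simp add: r_def)
  ultimately show ?thesis
    using square_residue_if_additive_relation[where r = r, OF two x(2) res] p' by blast
qed

end

lemma (in dyadic_completion) dyadic_field: "dyadic_field K v"
proof -
  interpret valued_subfield K v
    by unfold_locales (use subfield v_mult v_add in auto)
  have close: "v_close v N x y \<longleftrightarrow> x - y \<in> P N" if "x \<in> K" "y \<in> K" for x y N
    using that by (auto simp: v_close_def val_ge_def)
  have two: "2 \<in> P 1" using dyadic by (simp add: val_ge_def)
  show ?thesis
  proof
    have "1 \<in> v ` (K - {0})" using v_surj by simp
    then show "\<exists>p\<in>K. p \<noteq> 0 \<and> v p = 1" by auto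
    show "0 < v 2" by (rule dyadic)
  next
    fix s :: "nat \<Rightarrow> 'a"
    assume s: "\<And>n. s n \<in> K" and c: "\<And>N. \<exists>M. \<forall>m\<ge>M. \<forall>n\<ge>M. s m - s n \<in> P N"
    have "\<exists>l\<in>K. \<forall>N. \<exists>M. \<forall>n\<ge>M. v_close v N (s n) l"
    proof (rule complete[OF s])
      show "\<exists>M. \<forall>m\<ge>M. \<forall>n\<ge>M. v_close v N (s m) (s n)" for N using c[of N] close[OF s s] by simp
    qed
    then obtain l where l: "l \<in> K" "\<forall>N. \<exists>M. \<forall>n\<ge>M. v_close v N (s n) l" by auto
    then show "\<exists>l\<in>K. \<forall>N. \<exists>M. \<forall>n\<ge>M. s n - l \<in> P N" using close[OF s l(1)] by (intro bexI[of _ l]) auto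
  next
    fix x assume x: "x \<in> P 0"
    obtain F n where F: "extension_of_degree \<rat> F n" "F \<subseteq> K" "\<forall>x\<in>K. \<forall>N. \<exists>y\<in>F. v_close v N y x"
      using number_field_dense by auto
    \<comment> \<open>By density every residue class of \<open>K\<close> contains an element of the
      number field.\<close>
    then obtain y where y: "y \<in> F" "y - x \<in> P 1" using close P_k[OF x] by (metis subsetD)
    have "y \<in> P 0" using P_add[OF x P_mono[OF y(2), of 0]] by simp
    then obtain c where c: "c \<in> P 0" "y - c\<^sup>2 \<in> P 1"
      using perfect_if_number_field[OF two F(1,2) y(1)] by auto
    have "x - c\<^sup>2 \<in> P 1" using P_diff[OF c(2) y(2)] by simp
    then show "\<exists>c\<in>P 0. x - c\<^sup>2 \<in> P 1" using c by auto
  qed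
qed

section \<open>Pairs of ramified quadratic extensions\<close>

lemma (in quadratic) eq_if_common_generator:
  assumes "quadratic k E" "x \<in> L" "x \<in> E" "x \<notin> k"
  shows "L = E"
proof -
  interpret E: quadratic k E by fact
  show ?thesis
  proof (intro equalityI subsetI)
    fix y assume "y \<in> L"
    from generator_span[OF assms(2,4) this] obtain a b where "a \<in> k" "b \<in> k" "y = a + b * x" by metis
    then show "y \<in> E" using E.k_L assms by simp
  next
    fix y assume "y \<in> E"
    from E.generator_span[OF assms(3,4) this] obtain a b where "a \<in> k" "b \<in> k" "y = a + b * x" by metis
    then show "y \<in> L" using k_L assms by simp
  qed
qed

context quadratic_ext
begin

text \<open>A root of \<open>z\<^sup>2 - T z + c\<close> with integral \<open>T, c \<in> L\<close> is a root of the product of this polynomial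
  and its conjugate, whose coefficients are integers of \<open>k\<close>.\<close>

lemma integral_over_base:
  assumes T: "T \<in> PL 0" and c: "c \<in> PL 0" and x: "x \<in> M" "x\<^sup>2 - T * x + c = 0"
  shows "x \<in> int_ring (P 0) M"
proof -
  have L: "T \<in> L" "c \<in> L" using T c val_L.P_k by auto
  have int: "N y \<in> P 0" "Tr y \<in> P 0" if "y \<in> PL 0" for y
    using PL_iff_norm[of y 0] trace_P[of y 0 0] that val_L.P_k[OF that] by auto
  have base: "y \<in> PL 0" if "y \<in> P 0" for y using PL_base[OF P_k[OF that], of 0] that by simp
  obtain g where g: "g \<in> L" "g \<notin> k" using exists_generator by blast
  obtain a b a' b' where k: "a \<in> k" "b \<in> k" "a' \<in> k" "b' \<in> k"
    and eq: "T = a + b * g" "c = a' + b' * g"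
    using generator_span[OF g L(1)] generator_span[OF g L(2)] by metis
  \<comment> \<open>The trace of \<open>T\<close> times the conjugate of \<open>c\<close>: up to
    sign the linear coefficient of the product polynomial.\<close>
  define e where "e = T * Tr c + c * Tr T - 2 * T * c"
  have "e \<in> PL 0"
    unfolding e_def using T c int base val_L.P_numeral
    by (intro val_L.P_diff val_L.P_add val_L.P_mult_0) auto
  moreover have "e \<in> k"
  proof -
    have "e = 2 * a * a' + (a * b' + b * a') * Tr g + 2 * b * b' * (Tr g * g - g\<^sup>2)"
      unfolding e_def eq trace_gen[OF g k(1,2)] trace_gen[OF g k(3,4)]
      by (simp add: algebra_simps power2_eq_square)
    also have "Tr g * g - g\<^sup>2 = N g" using monic_quadratic_solve[OF charpoly[OF g(1)]] by simp
    finally show ?thesis using k g by simp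
  qed
  ultimately have e: "e \<in> P 0" using PL_base[of e 0] by simp
  define p where "p = [:N c, - e, Tr c + N T, - Tr T, 1:]"
  have "coeffs_in (P 0) p"
    unfolding p_def using int[OF T] int[OF c] e P_1
    by (auto simp: coeffs_in_def coeff_pCons P_add P_uminus split: nat.splits)
  moreover have "lead_coeff p = 1" by (simp add: p_def)
  moreover have "poly p x = 0"
  proof -
    have NT: "N T = T * (Tr T - T)" and Nc: "N c = c * (Tr c - c)"
      using monic_quadratic_solve[OF charpoly[OF L(1)]] monic_quadratic_solve[OF charpoly[OF L(2)]]
      by (simp_all add: algebra_simps power2_eq_square)
    have "poly p x = (x\<^sup>2 - T * x + c) * (x\<^sup>2 - (Tr T - T) * x + (Tr c - c))"
      unfolding p_def e_def NT Nc by (simp add: algebra_simps power2_eq_square)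
    then show ?thesis using x by simp
  qed
  ultimately show ?thesis using x(1) unfolding int_ring_def by blast
qed

end

locale ramified_quadratic = integral_quadratic_ext +
  assumes ramified: "is_ramified R k L"
begin

lemma exists_uniformizer: "\<exists>t\<in>L. t \<noteq> 0 \<and> W t = 1"
  using ramified_uniformizer[OF ramified] .

lemma dyadic_field_top: "dyadic_field L W"
  using exists_uniformizer dyadic_field_L by blast

text \<open>In \<open>D t\<close> the square \<open>(Tr t)^2\<close> has even valuation and
  \<open>4 * N t\<close> has the odd valuation \<open>2 w(2) + 1\<close>, so \<open>w (D t)\<close>
  is the smaller of the two. Either it equals \<open>2 w(2) + 1\<close>, or it is even and twice the
  valuation of the trace.\<close>

lemma uniformizer:
  assumes t: "t \<in> L" "t \<noteq> 0" "W t = 1"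
  shows uniformizer_notin: "t \<notin> k" and uniformizer_norm: "N t \<noteq> 0" "N t \<in> P 1"
    and uniformizer_trace: "Tr t \<in> P 1" and uniformizer_disc: "disc_ideal R k L = P (w (D t))"
    and uniformizer_trace_P: "Tr t \<in> P ((w (D t) + 1) div 2)"
    and uniformizer_disc_ge: "2 \<le> w (D t)" and uniformizer_disc_le: "w (D t) \<le> 2 * w 2 + 1"
    and uniformizer_disc_even: "w (D t) < 2 * w 2 + 1 \<Longrightarrow> Tr t \<noteq> 0 \<and> w (D t) = 2 * w (Tr t)"
proof -
  show "t \<notin> k" using uniformizer_not_base t by simp
  show N: "N t \<noteq> 0" "N t \<in> P 1" using t by (auto simp: norm_eq_0_iff P_iff)
  show T: "Tr t \<in> P 1" using trace_P[OF t(1) N(2)] by simp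
  show "disc_ideal R k L = P (w (D t))" using disc_ideal_odd[OF t(1,2), of 0] t by simp
  have "w (4 * N t) = w (2 * (2 * N t))" by simp
  also have "\<dots> = w 2 + (w 2 + w (N t))" using t N by (subst w_mult; (subst w_mult)?; simp)
  finally have w4: "w (- (4 * N t)) = 2 * w 2 + 1" using t by simp
  have *: "Tr t \<noteq> 0 \<Longrightarrow> w (D t) = min (2 * w (Tr t)) (2 * w 2 + 1)"
  proof -
    assume nz: "Tr t \<noteq> 0"
    have "w ((Tr t)\<^sup>2) = 2 * w (Tr t)" using nz t by (simp add: w_power)
    moreover from this have "w ((Tr t)\<^sup>2) \<noteq> w (- (4 * N t))" unfolding w4 by presburger
    ultimately show ?thesis
      using P_add_neq(2)[of "(Tr t)\<^sup>2" "- (4 * N t)"] nz N t w4 by simp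
  qed
  moreover have "Tr t = 0 \<Longrightarrow> w (D t) = 2 * w 2 + 1" using w4 by simp
  moreover have "Tr t \<noteq> 0 \<Longrightarrow> 1 \<le> w (Tr t)" using T by (simp add: val_ge_def)
  ultimately have cases: "Tr t = 0 \<and> w (D t) = 2 * w 2 + 1
      \<or> Tr t \<noteq> 0 \<and> 1 \<le> w (Tr t) \<and> w (D t) = min (2 * w (Tr t)) (2 * w 2 + 1)" by blast
  then show "2 \<le> w (D t)" "w (D t) \<le> 2 * w 2 + 1"
    "w (D t) < 2 * w 2 + 1 \<Longrightarrow> Tr t \<noteq> 0 \<and> w (D t) = 2 * w (Tr t)"
    using w_2 by (auto simp: min_def split: if_splits)
  show "Tr t \<in> P ((w (D t) + 1) div 2)"
  proof (cases "Tr t = 0")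
    case False
    then have "(w (D t) + 1) div 2 \<le> w (Tr t)" using cases by (auto simp: min_def)
    then show ?thesis using False t by (simp add: P_iff)
  qed simp
qed

end

section \<open>The compositum as a quadratic extension of either field\<close>

lemma compositum_eq:
  assumes "is_subfield L" "quadratic k M" "x \<in> M" "x \<notin> k" "k \<subseteq> L" "is_subfield {a + b * x |a b. a \<in> L \<and> b \<in> L}"
  shows "compositum M L = {a + b * x |a b. a \<in> L \<and> b \<in> L}" (is "_ = ?E")
proof
  interpret M: quadratic k M by fact
  have L: "y \<in> ?E" if "y \<in> L" for y
    by (rule CollectI, rule exI[of _ y], rule exI[of _ 0]) (simp add: that subfield_0[OF assms(1)])
  have M: "y \<in> ?E" if y: "y \<in> M" for y
  proof -
    obtain a b where "a \<in> k" "b \<in> k" "y = a + b * x" using M.generator_span[OF assms(3,4) y] by metis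
    then show ?thesis using assms(5) by auto
  qed
  show "compositum M L \<subseteq> ?E"
    unfolding compositum_def by (rule Inter_lower) (use assms(6) L M in \<open>simp add: subset_iff\<close>)
  show "?E \<subseteq> compositum M L"
    unfolding compositum_def
  proof clarify
    fix a b F assume ab: "a \<in> L" "b \<in> L" and F: "is_subfield F" and sub: "M \<union> L \<subseteq> F"
    then have "a \<in> F" "b \<in> F" "x \<in> F" using assms by auto
    then show "a + b * x \<in> F" by (intro subfield_add[OF F] subfield_mult[OF F])
  qed
qed

lemma compositum_commute: "compositum L M = compositum M L"
  by (simp add: compositum_def Un_commute)

locale ramified_pair =
  dyadic_field K v + A: ramified_quadratic K v kA R + B: ramified_quadratic K v kB R
  for K v kA kB R +
  assumes distinct: "kA \<noteq> kB" and R: "R = val_ge K v 0"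
begin

abbreviation M :: "'a set" where "M \<equiv> compositum kA kB"

lemma disjoint: "x \<in> kA \<Longrightarrow> x \<in> kB \<Longrightarrow> x \<in> K"
  using A.eq_if_common_generator[OF B.quadratic_axioms] distinct by blast

lemma swap: "ramified_pair K v kB kA R"
  by unfold_locales (use distinct R in auto)

sublocale dB: dyadic_field kB B.W by (rule B.dyadic_field_top)

lemma ext_M:
  assumes t: "t \<in> kA" "t \<notin> K"
  shows "extension_of_degree kB M 2"
proof -
  have tB: "t \<notin> kB" using disjoint t by blast
  have k: "- A.Tr t \<in> kB" "A.Tr t \<in> kB" "A.N t \<in> kB" using t B.k_L by auto
  note root = tB k(2,3) A.charpoly[OF t(1)]
  have M: "M = {a + b * t |a b. a \<in> kB \<and> b \<in> kB}"
    using quadratic_adjoin_subfield[OF B.sub_L root] B.k_L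
    by (intro compositum_eq[OF B.sub_L A.quadratic_axioms t]) auto
  show ?thesis
    unfolding M by (rule quadratic_adjoin[OF B.sub_L root])
qed

text \<open>The point is transitivity of integrality: integers of \<open>M\<close> over those of
  \<open>kB\<close> are integral over \<open>R\<close>, by
  \<open>integral_over_base\<close>.\<close>

sublocale M: integral_quadratic_ext kB B.W M R
proof -
  obtain t where t: "t \<in> kA" "t \<noteq> 0" "A.W t = 1" using A.exists_uniformizer by blast
  interpret M: quadratic_ext kB B.W M
    by unfold_locales (rule ext_M[OF t(1) A.uniformizer_not_base], use t in auto)
  have "int_ring R M = int_ring (B.PL 0) M"
  proof
    have "P 0 \<subseteq> B.PL 0"
    proof
      fix x assume "x \<in> P 0"
      then show "x \<in> B.PL 0" using B.PL_base[OF P_k, of x 0 0] by simp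
    qed
    then show "int_ring R M \<subseteq> int_ring (B.PL 0) M"
      unfolding R int_ring_def coeffs_in_def by blast
    show "int_ring (B.PL 0) M \<subseteq> int_ring R M"
      unfolding M.int_ring_L R
    proof
      fix x assume x: "x \<in> M.PL 0"
      then have xM: "x \<in> M" by (rule M.val_L.P_k)
      have N: "M.N x \<in> B.PL 0" using x M.PL_iff_norm[OF xM] by simp
      have T: "M.Tr x \<in> B.PL 0" using M.trace_P[OF xM N] by simp
      show "x \<in> int_ring (P 0) M" using B.integral_over_base[OF T N xM M.charpoly[OF xM]] .
    qed
  qed
  then show "integral_quadratic_ext kB B.W M R"
    by unfold_locales (simp_all add: B.R_L M.int_ring_L)
qed

section \<open>The norm of \<open>t - \<eta>\<close> and the relative discriminant\<close>

lemma t_M: "t \<in> kA \<Longrightarrow> t \<in> M"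
  unfolding compositum_def by blast

lemma M_trace_norm:
  assumes t: "t \<in> kA" "t \<notin> K"
  shows "M.Tr t = A.Tr t" "M.N t = A.N t"
proof -
  have "t \<notin> kB" "A.Tr t \<in> kB" "A.N t \<in> kB" using disjoint t B.k_L by auto
  then show "M.Tr t = A.Tr t" "M.N t = A.N t"
    using M.trace_eq[OF t_M[OF t(1)]] M.norm_eq[OF t_M[OF t(1)]] A.charpoly[OF t(1)] by simp_all
qed

text \<open>The characteristic polynomial of \<open>t\<close> over \<open>K\<close> evaluated at
  \<open>\<eta>\<close>. For \<open>t\<close> outside \<open>K\<close> and \<open>\<eta>\<close> in
  \<open>kB\<close> this is the norm of \<open>t - \<eta>\<close> from \<open>M\<close> to
  \<open>kB\<close>.\<close>

definition rel_norm :: "'a \<Rightarrow> 'a \<Rightarrow> 'a" where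
  "rel_norm t \<eta> = \<eta>\<^sup>2 - A.Tr t * \<eta> + A.N t"

lemma rel_norm_in [simp]: "t \<in> kA \<Longrightarrow> \<eta> \<in> kB \<Longrightarrow> rel_norm t \<eta> \<in> kB"
  unfolding rel_norm_def using B.k_L by simp

lemma rel_norm_eq_norm: "t \<in> kA \<Longrightarrow> t \<notin> K \<Longrightarrow> \<eta> \<in> kB \<Longrightarrow> M.N (t - \<eta>) = rel_norm t \<eta>"
  using M.norm_shift[of "- \<eta>" t] t_M[of t] M_trace_norm[of t] by (simp add: rel_norm_def)

lemma rel_norm_nonzero:
  assumes "t \<in> kA" "t \<notin> K" "\<eta> \<in> kB" shows "rel_norm t \<eta> \<noteq> 0"
proof -
  have "t \<noteq> \<eta>" using disjoint assms by blast
  then show ?thesis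
    using M.norm_eq_0_iff[of "t - \<eta>"] rel_norm_eq_norm[OF assms] t_M[OF assms(1)] assms(3) M.k_L by simp
qed

lemma rel_norm_linear:
  "\<eta> \<in> kB \<Longrightarrow> rel_norm t \<eta> = (A.N t - B.N \<eta>) + (B.Tr \<eta> - A.Tr t) * \<eta>"
  using monic_quadratic_solve[OF B.charpoly[of \<eta>]] by (simp add: rel_norm_def algebra_simps)

lemma rel_norm_PL:
  assumes "t \<in> kA" "\<eta> \<in> kB" "\<eta> \<noteq> 0" "B.W \<eta> = 1"
  shows "rel_norm t \<eta> \<in> B.PL m \<longleftrightarrow> A.N t - B.N \<eta> \<in> P ((m + 1) div 2) \<and> B.Tr \<eta> - A.Tr t \<in> P (m div 2)"
  unfolding rel_norm_linear[OF assms(2)] using assms by (intro B.PL_uniformizer) auto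

text \<open>\<open>A.N t\<close> has valuation 2 in \<open>kB\<close>. If \<open>\<eta>\<close> had
  valuation at least 2, this term would dominate; if at most 0, the term \<open>\<eta>^2\<close>
  would. Neither leaves valuation 3 or more.\<close>

lemma rel_norm_PL_3:
  assumes t: "t \<in> kA" "t \<noteq> 0" "A.W t = 1" and \<eta>: "\<eta> \<in> kB" "rel_norm t \<eta> \<in> B.PL 3"
  shows "\<eta> \<noteq> 0" "B.W \<eta> = 1"
proof -
  have N: "A.N t \<noteq> 0" "A.N t \<in> kB" "B.W (A.N t) = 2"
    using A.uniformizer_norm[OF t] t B.W_base[of "A.N t"] B.k_L by auto
  have T: "A.Tr t \<in> B.PL 2" using A.uniformizer_trace[OF t] t B.PL_base[of "A.Tr t" 2] by simp
  have N3: "A.N t \<notin> B.PL 3" and N2: "A.N t \<in> B.PL 2" using N by (auto simp: val_ge_def)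
  have eq: "A.N t = rel_norm t \<eta> - \<eta>\<^sup>2 + A.Tr t * \<eta>" "\<eta>\<^sup>2 = rel_norm t \<eta> + A.Tr t * \<eta> - A.N t"
    by (simp_all add: rel_norm_def)
  show nz: "\<eta> \<noteq> 0" using \<eta> N3 by (auto simp: rel_norm_def)
  have \<eta>P: "\<eta> \<in> B.PL (B.W \<eta>)" using \<eta> by (simp add: val_ge_def)
  show "B.W \<eta> = 1"
  proof (rule ccontr)
    assume "B.W \<eta> \<noteq> 1"
    then consider "2 \<le> B.W \<eta>" | "B.W \<eta> \<le> 0" by linarith
    then show False
    proof cases
      case 1
      then have \<eta>2: "\<eta> \<in> B.PL 2" using \<eta> by (simp add: val_ge_def)
      have "\<eta>\<^sup>2 \<in> B.PL 3" "A.Tr t * \<eta> \<in> B.PL 3"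
        using B.val_L.P_mono[OF B.val_L.P_power[OF \<eta>2, of 2], of 3]
          B.val_L.P_mono[OF B.val_L.P_mult[OF T \<eta>2], of 3] by simp_all
      then have "rel_norm t \<eta> - \<eta>\<^sup>2 + A.Tr t * \<eta> \<in> B.PL 3" using \<eta>(2) by (intro B.val_L.P_add B.val_L.P_diff)
      then show False using N3 eq(1) by simp
    next
      case 2
      have "rel_norm t \<eta> + A.Tr t * \<eta> - A.N t \<in> B.PL (2 * B.W \<eta> + 1)"
        using B.val_L.P_mono[OF \<eta>(2), of "2 * B.W \<eta> + 1"] B.val_L.P_mono[OF N2, of "2 * B.W \<eta> + 1"]
          B.val_L.P_mono[OF B.val_L.P_mult[OF T \<eta>P], of "2 * B.W \<eta> + 1"] 2
        by (intro B.val_L.P_add B.val_L.P_diff) simp_all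
      then have "\<eta>\<^sup>2 \<in> B.PL (2 * B.W \<eta> + 1)" using eq(2) by simp
      then show False using B.val_L.w_power[OF \<eta>(1) nz, of 2] nz by (simp add: val_ge_def)
    qed
  qed
qed

lemma relative_disc:
  assumes t: "t \<in> kA" "t \<noteq> 0" "A.W t = 1"
  obtains \<eta> where "\<eta> \<in> kB" "\<eta> \<noteq> 0" "B.W \<eta> = 1" "3 \<le> B.W (rel_norm t \<eta>)"
    "\<And>\<eta>'. \<eta>' \<in> kB \<Longrightarrow> B.W (rel_norm t \<eta>') \<le> B.W (rel_norm t \<eta>)"
    "disc_ideal R kB M = B.PL (2 * v (A.D t) - 2 * (B.W (rel_norm t \<eta>) div 2))"
    "even (B.W (rel_norm t \<eta>)) \<Longrightarrow> B.W (rel_norm t \<eta>) = 2 * v (A.D t)"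
proof -
  have tK: "t \<notin> K" using A.uniformizer_notin[OF t] .
  have tB: "t \<notin> kB" using disjoint tK t by blast
  have W: "M.W (t + c) = B.W (rel_norm t (- c))" if "c \<in> kB" for c
    using rel_norm_eq_norm[OF t(1) tK, of "- c"] that by simp
  have "A.D t \<in> K" "A.D t \<noteq> 0" using t A.discr_nonzero[OF t(1) tK] by simp_all
  then have D: "B.W (M.D t) = 2 * v (A.D t)"
    using B.W_base[of "A.D t"] M_trace_norm[OF t(1) tK] by simp
  obtain c where c: "c \<in> kB" "\<And>c'. c' \<in> kB \<Longrightarrow> M.W (t + c') \<le> M.W (t + c)"
    "disc_ideal R kB M = B.PL (B.W (M.D t) - 2 * (M.W (t + c) div 2))"
    "even (M.W (t + c)) \<Longrightarrow> M.W (t + c) = B.W (M.D t)"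
    using M.disc_ideal_max[OF t_M[OF t(1)] tB] by metis
  define \<eta> where "\<eta> = - c"
  have \<eta>: "\<eta> \<in> kB" and s: "M.W (t + c) = B.W (rel_norm t \<eta>)" using c W by (simp_all add: \<eta>_def)
  have max: "B.W (rel_norm t \<eta>') \<le> B.W (rel_norm t \<eta>)" if "\<eta>' \<in> kB" for \<eta>'
    using c(2)[of "- \<eta>'"] W[of "- \<eta>'"] that s by simp
  have "B.W (A.N t) = 2"
    using A.uniformizer_norm[OF t] t B.W_base[of "A.N t"] by auto
  then have "2 \<le> B.W (rel_norm t \<eta>)" using max[of 0] by (simp add: rel_norm_def)
  \<comment> \<open>\<open>\<eta> = 0\<close> attains 2, but an even maximum equals
    \<open>2 v(D t)\<close>, which is at least 4. So the maximum is at least 3, and the maximising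
    \<open>\<eta>\<close> is a uniformizer.\<close>
  moreover have "B.W (rel_norm t \<eta>) \<noteq> 2" using c(4) A.uniformizer_disc_ge[OF t] unfolding s D by auto
  ultimately have 3: "3 \<le> B.W (rel_norm t \<eta>)" by simp
  then have "rel_norm t \<eta> \<in> B.PL 3" using t \<eta> by (simp add: val_ge_def)
  from rel_norm_PL_3[OF t \<eta> this] show ?thesis using that[OF \<eta> _ _ 3 max] c(3,4) unfolding s D by simp
qed

lemma disc_if_trace_diff:
  assumes t: "t \<in> kA" "t \<noteq> 0" "A.W t = 1"
    and m: "\<And>\<eta>. \<eta> \<in> kB \<Longrightarrow> \<eta> \<noteq> 0 \<Longrightarrow> B.W \<eta> = 1 \<Longrightarrow> B.Tr \<eta> - A.Tr t \<noteq> 0 \<and> v (B.Tr \<eta> - A.Tr t) = m"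
    and less: "m < v (A.D t)"
  shows "disc_ideal R kB M = B.PL (2 * v (A.D t) - 2 * m)"
proof -
  obtain \<eta> where \<eta>: "\<eta> \<in> kB" "\<eta> \<noteq> 0" "B.W \<eta> = 1" and
    disc: "disc_ideal R kB M = B.PL (2 * v (A.D t) - 2 * (B.W (rel_norm t \<eta>) div 2))" and
    ev: "even (B.W (rel_norm t \<eta>)) \<Longrightarrow> B.W (rel_norm t \<eta>) = 2 * v (A.D t)"
    using relative_disc[OF t] by metis
  define s where "s = B.W (rel_norm t \<eta>)"
  have nz: "rel_norm t \<eta> \<noteq> 0" using rel_norm_nonzero[OF t(1) A.uniformizer_notin[OF t] \<eta>(1)] .
  have in_s: "rel_norm t \<eta> \<in> B.PL s" and not_s: "rel_norm t \<eta> \<notin> B.PL (s + 1)"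
    using nz t \<eta> by (auto simp: val_ge_def s_def)
  have tr: "B.Tr \<eta> - A.Tr t \<in> P j \<longleftrightarrow> j \<le> m" for j
    using m[OF \<eta>] t \<eta> by (simp add: P_iff)
  have "s div 2 \<le> m" using in_s rel_norm_PL[OF t(1) \<eta>] tr by simp
  \<comment> \<open>For odd \<open>s\<close>, passing from \<open>s\<close> to \<open>s + 1\<close>
    leaves the norm condition in \<open>rel_norm_PL\<close> unchanged. So it is the trace condition
    that fails at \<open>s + 1\<close>, and this pins \<open>s div 2\<close> to
    \<open>m\<close>.\<close>
  moreover have "odd s" using ev less \<open>s div 2 \<le> m\<close> unfolding s_def by (cases "even (B.W (rel_norm t \<eta>))") auto
  then have "(s + 1 + 1) div 2 = (s + 1) div 2" "(s + 1) div 2 = s div 2 + 1" by presburger+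
  then have "\<not> s div 2 + 1 \<le> m"
    using in_s not_s rel_norm_PL[OF t(1) \<eta>] tr by metis
  ultimately have "s div 2 = m" by simp
  then show ?thesis using disc by (simp add: s_def)
qed

section \<open>The level as half the maximal valuation\<close>

lemma level_eq:
  assumes t: "t \<in> kA" "t \<noteq> 0" "A.W t = 1"
    and \<eta>: "\<eta> \<in> kB" "\<eta> \<noteq> 0" "B.W \<eta> = 1" "3 \<le> B.W (rel_norm t \<eta>)"
    and max: "\<And>\<eta>'. \<eta>' \<in> kB \<Longrightarrow> B.W (rel_norm t \<eta>') \<le> B.W (rel_norm t \<eta>)"
  shows "int (level R K kB (- A.Tr t) (A.N t)) = B.W (rel_norm t \<eta>) div 2"
proof -
  define s where "s = B.W (rel_norm t \<eta>)"
  have tK: "t \<notin> K" using A.uniformizer_notin[OF t] .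
  have nonempty: "level_set R K kB (- A.Tr t) (A.N t) i \<noteq> {} \<longleftrightarrow>
      (\<exists>\<zeta>\<in>B.PL 0. B.Tr \<zeta> + A.Tr t \<in> P (int i) \<and> B.N \<zeta> - A.N t \<in> P (int i))" for i
    unfolding level_set_def B.R_L prime_pow_P[OF A.R_k] by auto
  have "level R K kB (- A.Tr t) (A.N t) = nat (s div 2)"
    unfolding level_def
  proof (rule Greatest_equality)
    have "rel_norm t \<eta> \<in> B.PL s" using t \<eta> by (simp add: val_ge_def s_def)
    then have P: "A.N t - B.N \<eta> \<in> P ((s + 1) div 2)" "B.Tr \<eta> - A.Tr t \<in> P (s div 2)"
      using rel_norm_PL[OF t(1) \<eta>(1-3)] by auto
    have s0: "0 \<le> s div 2" using \<eta>(4) by (simp add: s_def)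
    \<comment> \<open>The level compares traces with \<open>a1 = - A.Tr t\<close>, so the witness is
      \<open>- \<eta>\<close>.\<close>
    have "B.Tr (- \<eta>) = - B.Tr \<eta>" "B.N (- \<eta>) = B.N \<eta>"
      using B.trace_scale[of "-1" \<eta>] B.norm_scale[of "-1" \<eta>] \<eta> by simp_all
    moreover have "- (B.Tr \<eta> - A.Tr t) \<in> P (s div 2)" "- (A.N t - B.N \<eta>) \<in> P (s div 2)"
      using P_uminus[OF P(2)] P_uminus[OF P_mono[OF P(1), of "s div 2"]] by simp_all
    moreover have "- \<eta> \<in> B.PL 0" using \<eta> by (simp add: val_ge_def)
    ultimately show "level_set R K kB (- A.Tr t) (A.N t) (nat (s div 2)) \<noteq> {}"
      unfolding nonempty using s0 by (intro bexI[of _ "- \<eta>"]) auto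
  next
    fix i assume "level_set R K kB (- A.Tr t) (A.N t) i \<noteq> {}"
    then obtain \<zeta> where \<zeta>: "\<zeta> \<in> B.PL 0"
      and P: "B.Tr \<zeta> + A.Tr t \<in> P (int i)" "B.N \<zeta> - A.N t \<in> P (int i)"
      unfolding nonempty by blast
    have \<zeta>B: "\<zeta> \<in> kB" using B.val_L.P_k[OF \<zeta>] .
    \<comment> \<open>\<open>\<zeta>\<close> is an arbitrary integer of \<open>kB\<close>; for this
      direction the ultrametric estimate of \<open>rel_norm t (- \<zeta>)\<close> replaces the
      parity argument.\<close>
    have PB: "x \<in> B.PL (2 * int i)" if "x \<in> P (int i)" for x
      using B.PL_base[OF P_k[OF that], of "2 * int i"] that by simp
    have "(B.Tr \<zeta> + A.Tr t) * \<zeta> - (B.N \<zeta> - A.N t) \<in> B.PL (2 * int i)"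
      using B.val_L.P_diff[OF B.val_L.P_mult_0[OF \<zeta> PB[OF P(1)]] PB[OF P(2)]] by (simp add: mult.commute)
    also have "(B.Tr \<zeta> + A.Tr t) * \<zeta> - (B.N \<zeta> - A.N t) = rel_norm t (- \<zeta>)"
      using monic_quadratic_solve[OF B.charpoly[OF \<zeta>B]] by (simp add: rel_norm_def algebra_simps)
    finally have "2 * int i \<le> B.W (rel_norm t (- \<zeta>))"
      using rel_norm_nonzero[OF t(1) tK, of "- \<zeta>"] \<zeta>B by (simp add: val_ge_def)
    also have "\<dots> \<le> s" unfolding s_def using max \<zeta>B by simp
    finally show "i \<le> nat (s div 2)" by linarith
  qed
  then show ?thesis using \<eta>(4) by (simp add: s_def)
qed

text \<open>\<open>\<rho>\<close> is the product of square roots of the two discriminants. For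
  uniqueness, another field \<open>E\<close> has a generator with square in \<open>K\<close>;
  writing it over \<open>kB\<close> and then over \<open>K\<close>, with no mixed terms allowed,
  leaves only a \<open>K\<close>-multiple of \<open>\<rho>\<close>.\<close>

lemma
  assumes t: "t \<in> kA" "t \<notin> K" and \<eta>: "\<eta> \<in> kB" "\<eta> \<notin> K"
  defines "\<rho> \<equiv> (2 * t - A.Tr t) * (2 * \<eta> - B.Tr \<eta>)"
  shows third_gen_square: "\<rho>\<^sup>2 = A.D t * B.D \<eta>" and third_gen_notin: "\<rho> \<notin> K"
    and third_quadratic_eq: "third_quadratic K kA kB = {a + b * \<rho> |a b. a \<in> K \<and> b \<in> K}"
    and third_quadratic_ext: "extension_of_degree K (third_quadratic K kA kB) 2"
    and third_gen_in: "\<rho> \<in> third_quadratic K kA kB"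
proof -
  define r1 r2 where "r1 = 2 * t - A.Tr t" and "r2 = 2 * \<eta> - B.Tr \<eta>"
  have \<rho>: "\<rho> = r1 * r2" by (simp add: \<rho>_def r1_def r2_def)
  have sq: "r1\<^sup>2 = A.D t" "r2\<^sup>2 = B.D \<eta>"
    unfolding r1_def r2_def by (simp_all add: A.trace_norm_diff_square[OF t(1)] B.trace_norm_diff_square[OF \<eta>(1)])
  show \<rho>2: "\<rho>\<^sup>2 = A.D t * B.D \<eta>" by (simp add: \<rho> power_mult_distrib sq)
  have DK: "A.D t \<in> K" "B.D \<eta> \<in> K" using t \<eta> by simp_all
  have r1A: "r1 \<in> kA" and r2B: "r2 \<in> kB" using t \<eta> A.k_L B.k_L by (simp_all add: r1_def r2_def)
  have r1K: "r1 \<notin> K"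
  proof
    assume "r1 \<in> K"
    then have "(r1 + A.Tr t) / 2 \<in> K" using t by simp
    then show False using t by (simp add: r1_def)
  qed
  have r2K: "r2 \<notin> K"
  proof
    assume "r2 \<in> K"
    then have "(r2 + B.Tr \<eta>) / 2 \<in> K" using \<eta> by simp
    then show False using \<eta> by (simp add: r2_def)
  qed
  have nz: "r1 \<noteq> 0" "r2 \<noteq> 0" using r1K r2K by auto
  have r1B: "r1 \<notin> kB" and r2A: "r2 \<notin> kA" using disjoint r1A r2B r1K r2K by blast+
  have \<rho>B: "\<rho> \<notin> kB"
  proof
    assume "\<rho> \<in> kB"
    then have "\<rho> / r2 \<in> kB" using r2B by simp
    then show False using r1B nz by (simp add: \<rho>)
  qed
  have \<rho>A: "\<rho> \<notin> kA"
  proof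
    assume "\<rho> \<in> kA"
    then have "\<rho> / r1 \<in> kA" using r1A by simp
    then show False using r2A nz by (simp add: \<rho>)
  qed
  show \<rho>K: "\<rho> \<notin> K" using \<rho>B B.k_L by blast
  define k3 where "k3 = {a + b * \<rho> |a b. a \<in> K \<and> b \<in> K}"
  have ext3: "extension_of_degree K k3 2"
    unfolding k3_def using DK \<rho>2 by (intro quadratic_adjoin[OF sub \<rho>K, of 0 "- (A.D t * B.D \<eta>)"]) auto
  interpret E3: quadratic K k3 by unfold_locales (rule ext3)
  have "\<rho> = 0 + 1 * \<rho>" by simp
  then have \<rho>3: "\<rho> \<in> k3" unfolding k3_def using k_intros(1,2) by blast
  have r1M: "r1 \<in> M" using t_M[OF r1A] .
  have BM: "x \<in> M" if "x \<in> kB" for x using M.k_L that .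
  have "third_quadratic K kA kB = k3"
    unfolding third_quadratic_def
  proof (rule the_equality)
    have "k3 \<subseteq> M" unfolding k3_def using r1M r2B BM B.k_L by (auto simp: \<rho>)
    then show "extension_of_degree K k3 2 \<and> k3 \<noteq> kA \<and> k3 \<noteq> kB \<and> k3 \<subseteq> M"
      using ext3 \<rho>3 \<rho>A \<rho>B by auto
  next
    fix E assume E: "extension_of_degree K E 2 \<and> E \<noteq> kA \<and> E \<noteq> kB \<and> E \<subseteq> M"
    then interpret E: quadratic K E by unfold_locales auto
    obtain g where g: "g \<in> E" "g \<notin> K" using E.exists_generator by blast
    define s where "s = 2 * g - E.Tr g"
    have s2: "s\<^sup>2 \<in> K" using E.trace_norm_diff_square[OF g(1)] g by (simp add: s_def)
    have sE: "s \<in> E" using g E.k_L by (simp add: s_def)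
    have sK: "s \<notin> K"
    proof
      assume "s \<in> K"
      then have "(s + E.Tr g) / 2 \<in> K" using g by simp
      then show False using g by (simp add: s_def)
    qed
    have neq: "x \<noteq> s" if "x \<in> kA \<or> x \<in> kB" for x
      using A.eq_if_common_generator[OF E.quadratic_axioms, of s]
        B.eq_if_common_generator[OF E.quadratic_axioms, of s] E sE sK that by blast
    obtain \<alpha> \<beta> where ab: "\<alpha> \<in> kB" "\<beta> \<in> kB" "s = \<alpha> + \<beta> * r1"
      using M.generator_span[OF r1M r1B] E sE by (metis subsetD)
    \<comment> \<open>The mixed term of the square is \<open>2 a b r\<close>; if \<open>a b\<close>
      were nonzero, one could solve for \<open>r\<close> inside \<open>K'\<close>.\<close>
    have cross: "a * b = 0"
      if "quadratic K' L" "r \<notin> K'" "r\<^sup>2 \<in> K'" "a \<in> K'" "b \<in> K'" "(a + b * r)\<^sup>2 \<in> K'" for a b r K' L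
    proof (rule ccontr)
      interpret Q: quadratic K' L by fact
      assume nz: "a * b \<noteq> 0"
      have "2 * (a * b) * r = (a + b * r)\<^sup>2 - a\<^sup>2 - b\<^sup>2 * r\<^sup>2"
        by (simp add: algebra_simps power2_eq_square)
      then have "r = ((a + b * r)\<^sup>2 - a\<^sup>2 - b\<^sup>2 * r\<^sup>2) / (2 * (a * b))"
        using nz by (simp add: eq_divide_eq mult.commute)
      also have "\<dots> \<in> K'"
        using that by simp
      finally show False using that by simp
    qed
    have "\<alpha> * \<beta> = 0"
      using cross[OF M.quadratic_axioms r1B _ ab(1,2)] sq(1) DK(1) s2 B.k_L ab(3) by simp
    moreover have "\<beta> \<noteq> 0" using ab neq[of \<alpha>] by auto
    ultimately have s: "s = \<beta> * r1" using ab by simp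
    have "\<beta>\<^sup>2 = s\<^sup>2 / A.D t" using s nz sq(1) by (simp add: power_mult_distrib flip: sq(1))
    then have b2: "\<beta>\<^sup>2 \<in> K" using s2 DK by simp
    obtain c d where cd: "c \<in> K" "d \<in> K" "\<beta> = c + d * r2"
      using B.generator_span[OF r2B r2K ab(2)] by metis
    have "c * d = 0"
      using cross[OF B.quadratic_axioms r2K _ cd(1,2)] sq(2) DK(2) b2 cd(3) by simp
    moreover have "d \<noteq> 0"
    proof
      assume "d = 0"
      then have "s = c * r1" using s cd by simp
      then show False using neq[of "c * r1"] r1A cd A.k_L by simp
    qed
    ultimately have "s = d * \<rho>" using s cd by (simp add: \<rho> mult.assoc mult.left_commute mult.commute)
    then have "s \<in> k3" using \<rho>3 cd E3.k_L by simp
    then show "E = k3" using E.eq_if_common_generator[OF E3.quadratic_axioms sE _ sK] by simp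
  qed
  then show "third_quadratic K kA kB = {a + b * \<rho> |a b. a \<in> K \<and> b \<in> K}"
    "extension_of_degree K (third_quadratic K kA kB) 2" "\<rho> \<in> third_quadratic K kA kB"
    using ext3 \<rho>3 by (simp_all add: k3_def)
qed

text \<open>The norm of \<open>t - \<eta>\<close> from \<open>M\<close> to the third quadratic field \<open>k3\<close> is \<open>c + \<rho> / 2\<close>; its norm to \<open>K\<close>
  is the norm of \<open>rel_norm t \<eta>\<close>, and its discriminant is the product of those of \<open>t\<close> and \<open>\<eta>\<close>.\<close>

lemma third_disc:
  assumes t: "t \<in> kA" "t \<noteq> 0" "A.W t = 1" and \<eta>: "\<eta> \<in> kB" "\<eta> \<noteq> 0" "B.W \<eta> = 1"
  shows "odd (B.W (rel_norm t \<eta>)) \<Longrightarrow>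
      disc_ideal R K (third_quadratic K kA kB) = P (v (A.D t) + v (B.D \<eta>) - 2 * (B.W (rel_norm t \<eta>) div 2))"
    and "B.W (rel_norm t \<eta>) = v (A.D t) + v (B.D \<eta>) \<Longrightarrow> even (B.W (rel_norm t \<eta>)) \<Longrightarrow>
      disc_ideal R K (third_quadratic K kA kB) = P 0"
proof -
  have tK: "t \<notin> K" and \<eta>K: "\<eta> \<notin> K" using A.uniformizer_notin[OF t] B.uniformizer_notin[OF \<eta>] by auto
  note third = third_gen_square third_gen_notin third_quadratic_eq third_quadratic_ext third_gen_in
  note third = third[OF t(1) tK \<eta>(1) \<eta>K]
  define \<rho> where "\<rho> = (2 * t - A.Tr t) * (2 * \<eta> - B.Tr \<eta>)"
  define k3 where "k3 = third_quadratic K kA kB"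
  have \<rho>: "\<rho>\<^sup>2 = A.D t * B.D \<eta>" "\<rho> \<notin> K" "\<rho> \<in> k3" using third by (simp_all add: \<rho>_def k3_def)
  interpret E: quadratic_ext K v k3 by unfold_locales (use third in \<open>simp add: k3_def\<close>)
  interpret E: integral_quadratic_ext K v k3 R
    by unfold_locales (simp_all add: A.R_k, simp add: R E.int_ring_L)
  have DK: "A.D t \<in> K" "B.D \<eta> \<in> K" using t \<eta> by simp_all
  have tr: "E.Tr \<rho> = 0" "E.N \<rho> = - \<rho>\<^sup>2"
    using E.trace_eq[OF \<rho>(3,2), of 0 "- \<rho>\<^sup>2"] E.norm_eq[OF \<rho>(3,2), of 0 "- \<rho>\<^sup>2"] DK \<rho>(1) by simp_all
  \<comment> \<open>Write \<open>t\<close> and \<open>\<eta>\<close> as half of trace plus root of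
    discriminant. Conjugation over the third field changes the sign of both roots and fixes
    \<open>\<rho>\<close>; the product of \<open>t - \<eta>\<close> with its conjugate has component
    \<open>c\<close> in \<open>K\<close> and remainder \<open>\<rho> / 2\<close>.\<close>
  define c where "c = A.N t + B.N \<eta> - A.Tr t * B.Tr \<eta> / 2"
  have c: "c \<in> K" using t \<eta> by (simp add: c_def)
  have half: "1 / 2 \<in> K" by simp
  define p where "p = c + 1 / 2 * \<rho>"
  have p3: "p \<in> k3" using \<rho> c half E.k_L by (simp add: p_def)
  have pK: "p \<notin> K"
  proof
    assume "p \<in> K"
    then have "2 * (p - c) \<in> K" using c by simp
    then show False using \<rho>(2) by (simp add: p_def)
  qed
  have Trp: "E.Tr p = 2 * c" using E.trace_gen[OF \<rho>(3,2) c half] tr by (simp add: p_def)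
  have Np: "E.N p = c\<^sup>2 - \<rho>\<^sup>2 / 4"
    using E.norm_gen[OF \<rho>(3,2) c half] tr by (simp add: p_def power2_eq_square)
  have "B.N (rel_norm t \<eta>) = (A.N t - B.N \<eta>)\<^sup>2 + (A.N t - B.N \<eta>) * (B.Tr \<eta> - A.Tr t) * B.Tr \<eta>
      + (B.Tr \<eta> - A.Tr t)\<^sup>2 * B.N \<eta>"
    unfolding rel_norm_linear[OF \<eta>(1)] using t \<eta> by (intro B.norm_gen[OF \<eta>(1) \<eta>K]) simp_all
  also have "\<dots> = E.N p" unfolding Np \<rho>(1) c_def by (simp add: field_simps power2_eq_square)
  finally have W: "E.W p = B.W (rel_norm t \<eta>)" by simp
  have "E.D p = A.D t * B.D \<eta>" unfolding Trp Np using \<rho>(1) by (simp add: power_mult_distrib)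
  then have D: "v (E.D p) = v (A.D t) + v (B.D \<eta>)"
    using w_mult[OF DK] A.discr_nonzero[OF t(1) tK] B.discr_nonzero[OF \<eta>(1) \<eta>K] by simp
  have p0: "p \<noteq> 0" using pK by auto
  show "disc_ideal R K (third_quadratic K kA kB) = P (v (A.D t) + v (B.D \<eta>) - 2 * (B.W (rel_norm t \<eta>) div 2))"
    if "odd (B.W (rel_norm t \<eta>))"
    using E.disc_ideal_odd[OF p3 p0, of "B.W (rel_norm t \<eta>) div 2"] W D that by (simp add: k3_def)
  show "disc_ideal R K (third_quadratic K kA kB) = P 0"
    if "B.W (rel_norm t \<eta>) = v (A.D t) + v (B.D \<eta>)" "even (B.W (rel_norm t \<eta>))"
  proof -
    have "E.N p \<in> P (2 * (B.W (rel_norm t \<eta>) div 2))"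
      using that(2) W p3 p0 by (simp add: P_iff E.norm_eq_0_iff)
    from E.disc_ideal_unit[OF p3 pK this] show ?thesis using D that by (simp add: k3_def)
  qed
qed

end

theorem proposition3p16:
  fixes K k1 k2 R :: "'a::{alg_closed_field, field_char_0} set"
    and v :: "'a \<Rightarrow> int"
    and \<delta>1 \<delta>2 l1 l2 :: nat
  assumes "dyadic_completion K v"
    and "\<forall>x. algebraic_over K x"
    and "R = valuation_ring K v"
    and "extension_of_degree K k1 2" and "is_ramified R K k1"
    and "extension_of_degree K k2 2" and "is_ramified R K k2"
    and "k1 \<noteq> k2"
    and "disc_ideal R K k1 = prime_pow R K \<delta>1"
    and "disc_ideal R K k2 = prime_pow R K \<delta>2"
    and "l1 = (\<delta>1 + 1) div 2" and "l2 = (\<delta>2 + 1) div 2"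
  shows "(\<forall>a1 a2 t \<delta> l i.
            is_eisenstein R K [:a2, a1, 1:] \<and>
            is_uniformizer R k1 t \<and> is_min_poly K t [:a2, a1, 1:] \<and>
            l1 = l \<and> l2 = l \<and> \<delta>1 = \<delta> \<and> \<delta>2 = \<delta> \<and>
            i = level R K k2 a1 a2 \<and> l \<le> i \<and> i \<le> \<delta> \<longrightarrow>
            disc_ideal R k2 (compositum k1 k2) = prime_pow R k2 (2 * (\<delta> - i)) \<and>
            disc_ideal R K (third_quadratic K k1 k2) = prime_pow R K (2 * (\<delta> - i))) \<and>
         (l1 > l2 \<longrightarrow>
            disc_ideal R k1 (compositum k1 k2) = prime_pow R k1 \<delta>2 \<and>
            disc_ideal R k2 (compositum k1 k2) = prime_pow R k2 (2 * \<delta>1 - \<delta>2))"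
proof -
  interpret dyadic_field K v by (rule dyadic_completion.dyadic_field) fact
  have R: "R = P 0" using assms(3) by (simp add: valuation_ring_eq_val_ge)
  have pair: "ramified_pair K v kA kB R"
    if "extension_of_degree K kA 2" "extension_of_degree K kB 2" "is_ramified R K kA" "is_ramified R K kB"
      "kA \<noteq> kB" for kA kB
  proof -
    interpret A: quadratic_ext K v kA by unfold_locales fact
    interpret B: quadratic_ext K v kB by unfold_locales fact
    show ?thesis
      by unfold_locales (use that in \<open>simp_all add: R int_ring_self A.int_ring_L B.int_ring_L\<close>)
  qed
  interpret X: ramified_pair K v k1 k2 R using assms by (intro pair)
  interpret Y: ramified_pair K v k2 k1 R by (rule X.swap)
  have disc1: "v (X.A.D t) = int \<delta>1" if "t \<in> k1" "t \<noteq> 0" "X.A.W t = 1" for t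
    using X.A.uniformizer_disc[OF that] assms(9) prime_pow_P[OF X.A.R_k] by simp
  have disc2: "v (X.B.D t) = int \<delta>2" if "t \<in> k2" "t \<noteq> 0" "X.B.W t = 1" for t
    using X.B.uniformizer_disc[OF that] assms(10) prime_pow_P[OF X.A.R_k] by simp
  have "disc_ideal R k2 (compositum k1 k2) = prime_pow R k2 (2 * (\<delta> - i)) \<and>
      disc_ideal R K (third_quadratic K k1 k2) = prime_pow R K (2 * (\<delta> - i))"
    if eis: "is_eisenstein R K [:a2, a1, 1:]" and unif: "is_uniformizer R k1 t"
      and min: "is_min_poly K t [:a2, a1, 1:]"
      and \<delta>: "\<delta>1 = \<delta>" "\<delta>2 = \<delta>" and i: "i = level R K k2 a1 a2" "i \<le> \<delta>" for a1 a2 t \<delta> i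
  proof -
    have t: "t \<in> k1" using unif by (simp add: is_uniformizer_def int_ring_def)
    have a: "a1 \<in> K" "a2 \<in> K"
      using min coeffs_in_def[of K "[:a2, a1, 1:]"] unfolding is_min_poly_def
      by (metis coeff_pCons_0 coeff_pCons_Suc)+
    have root: "t\<^sup>2 - - a1 * t + a2 = 0"
      using min by (simp add: is_min_poly_def algebra_simps power2_eq_square)
    have tK: "t \<notin> K"
    proof
      assume "t \<in> K"
      then have "coeffs_in K [:- t, 1:]" by (auto simp: coeffs_in_def coeff_pCons split: nat.splits)
      then have "degree [:a2, a1, 1:] \<le> degree [:- t, 1:]"
        using min unfolding is_min_poly_def by (elim conjE allE[of _ "[:- t, 1:]"]) auto
      then show False by simp
    qed
    have eq: "X.A.Tr t = - a1" "X.A.N t = a2"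
      using X.A.trace_eq[OF t tK _ a(2) root] X.A.norm_eq[OF t tK _ a(2) root] a by simp_all
    have "a2 \<in> prime_ideal R K" "a2 \<notin> prime_pow R K 2"
      using eis by (auto simp: is_eisenstein_def)
    then have "a2 \<in> P 1" "a2 \<notin> P 2"
      using prime_ideal_eq_P[OF X.A.R_k] prime_pow_P[OF X.A.R_k, of 2] by auto
    \<comment> \<open>The Eisenstein condition says that \<open>a2\<close>, the norm of
      \<open>t\<close>, has valuation exactly 1.\<close>
    then have t': "t \<noteq> 0" "X.A.W t = 1"
      using eq X.A.norm_eq_0_iff[OF t] by (auto simp: val_ge_def)
    note t = t t'
    obtain \<eta> where \<eta>: "\<eta> \<in> k2" "\<eta> \<noteq> 0" "X.B.W \<eta> = 1" "3 \<le> X.B.W (X.rel_norm t \<eta>)"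
      and max: "\<And>\<eta>'. \<eta>' \<in> k2 \<Longrightarrow> X.B.W (X.rel_norm t \<eta>') \<le> X.B.W (X.rel_norm t \<eta>)"
      and disc: "disc_ideal R k2 (compositum k1 k2)
        = X.B.PL (2 * v (X.A.D t) - 2 * (X.B.W (X.rel_norm t \<eta>) div 2))"
      and ev: "even (X.B.W (X.rel_norm t \<eta>)) \<Longrightarrow> X.B.W (X.rel_norm t \<eta>) = 2 * v (X.A.D t)"
      using X.relative_disc[OF t] by metis
    have lev: "int i = X.B.W (X.rel_norm t \<eta>) div 2"
      using X.level_eq[OF t \<eta> max] eq i by simp
    have d: "v (X.A.D t) = int \<delta>" "v (X.B.D \<eta>) = int \<delta>"
      using disc1[OF t] disc2[OF \<eta>(1-3)] \<delta> by simp_all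
    have nat: "int (2 * (\<delta> - i)) = 2 * int \<delta> - 2 * int i" using i(2) by (simp add: of_nat_diff)
    have "disc_ideal R k2 (compositum k1 k2) = prime_pow R k2 (2 * (\<delta> - i))"
      unfolding X.dB.prime_pow_P[OF X.B.R_L] nat lev disc d ..
    moreover have "disc_ideal R K (third_quadratic K k1 k2) = prime_pow R K (2 * (\<delta> - i))"
      unfolding prime_pow_P[OF X.A.R_k] nat
    \<comment> \<open>In the even case the maximum is \<open>2 \<delta>\<close>, so the level equals
      \<open>\<delta>\<close> and both discriminants are trivial.\<close>
    proof (cases "even (X.B.W (X.rel_norm t \<eta>))")
      case True
      then show "disc_ideal R K (third_quadratic K k1 k2) = P (2 * int \<delta> - 2 * int i)"
        using X.third_disc(2)[OF t \<eta>(1-3)] ev lev d by simp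
    next
      case False
      then show "disc_ideal R K (third_quadratic K k1 k2) = P (2 * int \<delta> - 2 * int i)"
        using X.third_disc(1)[OF t \<eta>(1-3)] lev d by simp
    qed
    ultimately show ?thesis by simp
  qed
  moreover have "disc_ideal R k1 (compositum k1 k2) = prime_pow R k1 \<delta>2 \<and>
      disc_ideal R k2 (compositum k1 k2) = prime_pow R k2 (2 * \<delta>1 - \<delta>2)" if less: "l1 > l2"
  proof -
    obtain t1 where t1: "t1 \<in> k1" "t1 \<noteq> 0" "X.A.W t1 = 1" using X.A.exists_uniformizer by blast
    obtain t2 where t2: "t2 \<in> k2" "t2 \<noteq> 0" "X.B.W t2 = 1" using X.B.exists_uniformizer by blast
    have l: "int l1 = (int \<delta>1 + 1) div 2" "int l2 = (int \<delta>2 + 1) div 2"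
      using assms(11,12) by (simp_all add: zdiv_int)
    \<comment> \<open>\<open>\<delta>1 \<le> 2 v(2) + 1\<close> gives
      \<open>l1 \<le> v(2) + 1\<close>, hence \<open>l2 \<le> v(2)\<close>. So
      \<open>\<delta>2\<close> stays below the exceptional value \<open>2 v(2) + 1\<close> and is
      even, equal to \<open>2 l2\<close>.\<close>
    have "int \<delta>1 \<le> 2 * v 2 + 1" using X.A.uniformizer_disc_le[OF t1] disc1[OF t1] by simp
    then have \<delta>2: "int \<delta>2 < 2 * v 2 + 1" using less l by linarith
    have tr1: "X.A.Tr t \<in> P (int l2 + 1)" if "t \<in> k1" "t \<noteq> 0" "X.A.W t = 1" for t
      using P_mono[OF X.A.uniformizer_trace_P[OF that], of "int l2 + 1"] disc1[OF that] l less by simp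
    have tr2: "X.B.Tr t \<noteq> 0" "v (X.B.Tr t) = int l2" "int \<delta>2 = 2 * int l2"
      if "t \<in> k2" "t \<noteq> 0" "X.B.W t = 1" for t
      using X.B.uniformizer_disc_even[OF that] disc2[OF that] \<delta>2 l by simp_all
    \<comment> \<open>Uniformizers of \<open>k2\<close> have trace of valuation exactly
      \<open>l2\<close>, those of \<open>k1\<close> a trace in \<open>P (l2 + 1)\<close>. So every
      difference of such traces has valuation \<open>l2\<close>, whichever field is taken as
      base.\<close>
    have diff: "x + y \<noteq> 0" "v (x + y) = int l2"
      if "x \<in> K" "x \<noteq> 0" "v x = int l2" "y \<in> P (int l2 + 1)" for x y
      using w_add_eq[of x y] that by simp_all
    \<comment> \<open>Positivity of \<open>\<delta>2 = 2 l2\<close> gives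
      \<open>l2 < \<delta>2\<close>, the strict inequality required when the fields are
      exchanged.\<close>
    have \<delta>2_ge: "2 \<le> int \<delta>2" using X.B.uniformizer_disc_ge[OF t2] disc2[OF t2] by simp
    have "disc_ideal R k2 (compositum k1 k2) = X.B.PL (2 * v (X.A.D t1) - 2 * int l2)"
    proof (rule X.disc_if_trace_diff[OF t1])
      fix \<eta> assume \<eta>: "\<eta> \<in> k2" "\<eta> \<noteq> 0" "X.B.W \<eta> = 1"
      show "X.B.Tr \<eta> - X.A.Tr t1 \<noteq> 0 \<and> v (X.B.Tr \<eta> - X.A.Tr t1) = int l2"
        using diff[OF _ tr2(1,2)[OF \<eta>] P_uminus[OF tr1[OF t1]]] \<eta> by simp
    qed (use disc1[OF t1] l less in linarith)
    also have "2 * v (X.A.D t1) - 2 * int l2 = int (2 * \<delta>1 - \<delta>2)"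
      using disc1[OF t1] tr2(3)[OF t2] l less by linarith
    finally have 2: "disc_ideal R k2 (compositum k1 k2) = prime_pow R k2 (2 * \<delta>1 - \<delta>2)"
      unfolding X.dB.prime_pow_P[OF X.B.R_L] .
    have "disc_ideal R k1 (compositum k2 k1) = X.A.PL (2 * v (X.B.D t2) - 2 * int l2)"
    proof (rule Y.disc_if_trace_diff[OF t2])
      fix \<eta> assume \<eta>: "\<eta> \<in> k1" "\<eta> \<noteq> 0" "X.A.W \<eta> = 1"
      have t2K: "X.B.Tr t2 \<in> K" using t2 by simp
      show "X.A.Tr \<eta> - X.B.Tr t2 \<noteq> 0 \<and> v (X.A.Tr \<eta> - X.B.Tr t2) = int l2"
        using diff[of "- X.B.Tr t2", OF _ _ _ tr1[OF \<eta>]] tr2[OF t2] t2K by simp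
    qed (use disc2[OF t2] tr2(3)[OF t2] \<delta>2_ge in linarith)
    also have "2 * v (X.B.D t2) - 2 * int l2 = int \<delta>2"
      using disc2[OF t2] tr2(3)[OF t2] by linarith
    finally have "disc_ideal R k1 (compositum k1 k2) = prime_pow R k1 \<delta>2"
      unfolding Y.dB.prime_pow_P[OF X.A.R_L] compositum_commute[of k1] .
    with 2 show ?thesis by simp
  qed
  ultimately show ?thesis by blast
qed

end
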